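(* Let $\gamma$ be the standard Gaussian measure on $\mathbb{R}^n$, let $f:\mathbb{R}^n\to\mathbb{R}$ be twice-differentiable, and suppose that $d\nu = e^f\,d\gamma$ defines a probability measure $\nu$ on $\mathbb{R}^n$. Assume that the relative entropy $\mathrm{D_{KL}}(\nu\,||\,\gamma)=\int_{\mathbb{R}^n} f\,d\nu$ and the Fisher information $\mathcal{I}(\nu)=\int_{\mathbb{R}^n}|\nabla f|^2\,d\nu$ are finite. Let $K=\{\nabla f(x): x\in\mathbb{R}^n\}$, assume that $y\mapsto \sup_{t\in K}\langle y,t\rangle$ is integrable with respect to $\gamma$, and set $\mathcal{D}(\nu)=\int_{\mathbb{R}^n}\sup_{t\in K}\langle y,t\rangle\,d\gamma(y)$. Assume that $\nu$ has a finite second moment. Then $$\int_{\mathbb{R}^n}|x|^2\,d\nu-\int_{\mathbb{R}^n}|x|^2\,d\gamma\;\leq\;2\,\mathrm{D_{KL}}\big(\nu\,||\,\gamma\big)+\mathcal{D}(\nu).$$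
   Context: $\langle\cdot,\cdot\rangle$ and $|\cdot|$ denote the Euclidean inner product and norm on $\mathbb{R}^n$. The quantity $\mathcal{D}(\nu)$ is the Gaussian-width of the set $K$ of gradients of $f$. *)

theory Defs
  imports "HOL-Probability.Probability"
begin

definition std_gaussian :: "'a::euclidean_space measure" where
  "std_gaussian =
     density lborel (\<lambda>x. ennreal ((2 * pi) powr (- real DIM('a) / 2) * exp (- (norm x)\<^sup>2 / 2)))"

lemma sets_std_gaussian [measurable_cong, simp]: "sets std_gaussian = sets borel"
  by (simp add: std_gaussian_def)

lemma prob_space_std_gaussian: "prob_space (std_gaussian :: 'a::euclidean_space measure)"
proof
  let ?g = "\<lambda>x::'a. ennreal ((2 * pi) powr (- real DIM('a) / 2) * exp (- (norm x)\<^sup>2 / 2))"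
  have factors: "?g x = (\<Prod>b\<in>Basis. ennreal (std_normal_density (x \<bullet> b)))" for x :: 'a
  proof -
    have "(norm x)\<^sup>2 = (\<Sum>b\<in>Basis. (x \<bullet> b)\<^sup>2)"
      unfolding power2_norm_eq_inner by (subst euclidean_inner) (simp add: power2_eq_square)
    then have e: "exp (- (norm x)\<^sup>2 / 2) = (\<Prod>b\<in>Basis. exp (- (x \<bullet> b)\<^sup>2 / 2))"
      by (simp add: exp_sum [symmetric] sum_negf sum_divide_distrib)
    have "1 / sqrt (2 * pi) = (2 * pi) powr (- 1 / 2)"
      by (simp add: powr_minus_divide powr_half_sqrt)
    then have "(1 / sqrt (2 * pi)) ^ DIM('a) = (2 * pi) powr (- real DIM('a) / 2)"
      by (simp add: powr_realpow [symmetric] powr_powr)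
    then have "(2 * pi) powr (- real DIM('a) / 2) * exp (- (norm x)\<^sup>2 / 2)
        = (\<Prod>b\<in>Basis. std_normal_density (x \<bullet> b))"
      unfolding std_normal_density_def e prod.distrib by simp
    then show ?thesis
      by (simp add: prod_ennreal)
  qed
  have "emeasure std_gaussian (space (std_gaussian :: 'a measure)) = (\<integral>\<^sup>+x. ?g x \<partial>lborel)"
    unfolding std_gaussian_def by (subst emeasure_density) auto
  also have "\<dots> = (\<Prod>b\<in>(Basis::'a set). \<integral>\<^sup>+t. ennreal (std_normal_density t) \<partial>lborel)"
    unfolding factors by (rule nn_integral_lborel_prod) auto
  also have "(\<integral>\<^sup>+t. ennreal (std_normal_density t) \<partial>lborel) = 1"
    using prob_space.emeasure_space_1 [OF prob_space_normal_density [of 1 0]]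
    by (simp add: emeasure_density)
  finally show "emeasure std_gaussian (space (std_gaussian :: 'a measure)) = 1"
    by simp
qed

definition grad :: "('a::real_inner \<Rightarrow> real) \<Rightarrow> 'a \<Rightarrow> 'a" where
  "grad f x = (THE D. GDERIV f x :> D)"

lemma grad_eqI:
  assumes "GDERIV f x :> D"
  shows "grad f x = D"
proof -
  have "D' = D" if "GDERIV f x :> D'" for D'
  proof -
    have "(\<lambda>h. h \<bullet> D') = (\<lambda>h. h \<bullet> D)"
      using that assms unfolding gderiv_def by (rule has_derivative_unique)
    then show ?thesis
      by (metis vector_eq_ldot)
  qed
  then show ?thesis
    unfolding grad_def using assms by (rule the_equality[rotated])
qed

definition twice_differentiable :: "('a::real_inner \<Rightarrow> real) \<Rightarrow> bool" where
  "twice_differentiable f \<longleftrightarrow>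
     (\<forall>x. f differentiable (at x)) \<and> (\<forall>x. grad f differentiable (at x))"

text \<open>The supremum is taken in the extended reals, since the supremum of an unbounded set of
  reals is unspecified.\<close>

definition support_fun :: "'a::real_inner set \<Rightarrow> 'a \<Rightarrow> ereal" where
  "support_fun K y = (SUP t\<in>K. ereal (y \<bullet> t))"

text \<open>Lebesgue integrability of an extended-real-valued function; it entails finiteness almost
  everywhere, so that \<^const>\<open>real_of_ereal\<close> loses nothing in the integral.\<close>

definition ereal_integrable :: "'a measure \<Rightarrow> ('a \<Rightarrow> ereal) \<Rightarrow> bool" where
  "ereal_integrable M h \<longleftrightarrow> h \<in> borel_measurable M \<and> (\<integral>\<^sup>+x. e2ennreal \<bar>h x\<bar> \<partial>M) < \<infinity>"

definition gaussian_width :: "'a::euclidean_space set \<Rightarrow> real" where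
  "gaussian_width K = (\<integral>y. real_of_ereal (support_fun K y) \<partial>std_gaussian)"

lemma KL_divergence_exp_density:
  fixes f :: "'a::euclidean_space \<Rightarrow> real"
  assumes [measurable]: "f \<in> borel_measurable borel"
  defines "\<nu> \<equiv> density std_gaussian (\<lambda>x. ennreal (exp (f x)))"
  shows "KL_divergence (exp 1) std_gaussian \<nu> = (\<integral>x. f x \<partial>\<nu>)"
proof -
  interpret prob_space "std_gaussian :: 'a measure"
    by (rule prob_space_std_gaussian)
  have "KL_divergence (exp 1) std_gaussian \<nu>
      = (\<integral>x. exp (f x) * log (exp 1) (exp (f x)) \<partial>std_gaussian)"
    unfolding \<nu>_def by (rule KL_density) auto
  also have "\<dots> = (\<integral>x. f x \<partial>\<nu>)"
    unfolding \<nu>_def by (subst integral_real_density) (auto simp: log_def)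
  finally show ?thesis .
qed

end

(* By sublinearity a finite-almost-everywhere support function is finite, so K is bounded and f
   is Lipschitz, with f (x + y) <= f x + h y for the support function h of K.

   For s > 0 let w^s solve w_t = s/2 Laplace(w) + |grad w|^2/2 with initial value f; Hopf-Cole
   makes exp (w^s/s) a Gaussian convolution of exp (f/s). In its stochastic control representation
   w^s(1,0) = sup_U E[f (sqrt s B + U) - |U'|^2/2], replacing sqrt s B by B costs at most
   (sqrt s - 1) E h(B), so for c > 1
     c^2 ln E exp (f (c x) / c^2) <= ln E exp (f x) + (c - 1) E h.
   Substituting y = c x on the left and applying Jensen with respect to nu bounds the left-hand
   side from below by (c^2 - 1) (E_nu |x|^2 / 2 - D) - c^2 n ln c; dividing by c - 1 and letting
   c -> 1 gives the theorem.

   The control representation is replaced by an argument in discrete time. Over one time step,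
   Jensen and a shift of the Gaussian give E w(x + z + u) - |u|^2/2 <= ln E exp w(x + z) for each
   constant u. In the other direction, Talagrand's transport inequality in its dual form gives
   ln E exp w(x + z) <= E sup_u (w(x + z + u) - |u|^2/2), which also covers anticipating
   controls. The two bounds differ only by one additional averaging over a time step, and this
   error does not accumulate. *)

theory Submission
  imports Defs "HOL-Real_Asymp.Real_Asymp"
begin

section \<open>Gaussian integrals of Lipschitz functions\<close>

definition gauss_density :: "'a::euclidean_space \<Rightarrow> real" where
  "gauss_density x = (2 * pi) powr (- real DIM('a) / 2) * exp (- (norm x)\<^sup>2 / 2)"

lemma gauss_density_pos [simp]: "0 < gauss_density x"
  by (simp add: gauss_density_def)

lemma gauss_density_nonneg [simp]: "0 \<le> gauss_density x"
  by (simp add: less_imp_le)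

lemma gauss_density_neq_0 [simp]: "gauss_density x \<noteq> 0"
  by (simp add: less_imp_neq[symmetric])

lemma continuous_on_gauss_density [continuous_intros]:
  "continuous_on S g \<Longrightarrow> continuous_on S (\<lambda>x. gauss_density (g x))"
  unfolding gauss_density_def by (intro continuous_intros) auto

lemma borel_measurable_gauss_density [measurable]: "gauss_density \<in> borel_measurable borel"
  by (intro borel_measurable_continuous_onI continuous_intros)

lemma std_gaussian_eq: "std_gaussian = density lborel (\<lambda>x. ennreal (gauss_density x))"
  by (simp add: std_gaussian_def gauss_density_def)

lemma space_std_gaussian [simp]: "space std_gaussian = UNIV"
  by (simp add: std_gaussian_def)

interpretation gaussian: prob_space "std_gaussian :: 'a::euclidean_space measure"
  by (rule prob_space_std_gaussian)

lemma measure_std_gaussian_UNIV [simp]: "measure std_gaussian UNIV = 1"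
  using gaussian.prob_space by simp

lemma nn_integral_lborel_affine:
  fixes t :: "'a::euclidean_space"
  assumes [measurable]: "F \<in> borel_measurable borel" and c: "c \<noteq> 0"
  shows "(\<integral>\<^sup>+x. F x \<partial>lborel) = ennreal (\<bar>c\<bar> ^ DIM('a)) * (\<integral>\<^sup>+x. F (t + c *\<^sub>R x) \<partial>lborel)"
  by (subst lborel_affine[OF c, of t])
     (simp add: nn_integral_density nn_integral_distr nn_integral_cmult)

lemma nn_integral_gaussian:
  assumes [measurable]: "F \<in> borel_measurable borel"
  shows "(\<integral>\<^sup>+x. F x \<partial>std_gaussian) = (\<integral>\<^sup>+x. ennreal (gauss_density x) * F x \<partial>lborel)"
  unfolding std_gaussian_eq by (rule nn_integral_density) auto

lemma integrable_gaussian_iff: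
  fixes F :: "'a::euclidean_space \<Rightarrow> real"
  assumes [measurable]: "F \<in> borel_measurable borel"
  shows "integrable std_gaussian F \<longleftrightarrow> integrable lborel (\<lambda>x. gauss_density x * F x)"
  unfolding std_gaussian_eq by (subst integrable_density) auto

lemma integral_gaussian:
  fixes F :: "'a::euclidean_space \<Rightarrow> real"
  assumes [measurable]: "F \<in> borel_measurable borel"
  shows "(\<integral>x. F x \<partial>std_gaussian) = (\<integral>x. gauss_density x * F x \<partial>lborel)"
  unfolding std_gaussian_eq by (subst integral_density) auto

lemma nn_integral_gauss_density: "(\<integral>\<^sup>+x. ennreal (gauss_density (x::'a::euclidean_space)) \<partial>lborel) = 1"
  using nn_integral_gaussian[of "\<lambda>x::'a. 1"] gaussian.emeasure_space_1[where 'a='a] by simp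

text \<open>Completing the square, \<open>L * norm x - (norm x)^2 / 2\<close> is at most
  \<open>L^2 - (norm x)^2 / 4\<close>, so the integrand is dominated by a multiple of a Gaussian
  density of variance 2, which is a dilation of \<open>gauss_density\<close>. The integrability of
  Lipschitz functions and of their exponentials rests on this bound.\<close>

lemma gaussian_integrable_exp_norm:
  "integrable (std_gaussian :: 'a::euclidean_space measure) (\<lambda>x. exp (L * norm x))"
proof -
  let ?k = "(2 * pi) powr (- real DIM('a) / 2)"
  define G where "G = (\<lambda>x::'a. gauss_density ((1 / sqrt 2) *\<^sub>R x))"
  have [measurable]: "G \<in> borel_measurable borel"
    unfolding G_def by (intro borel_measurable_continuous_onI continuous_intros)
  have "(\<integral>\<^sup>+x. ennreal (G x) \<partial>lborel) = ennreal (\<bar>sqrt 2\<bar> ^ DIM('a)) * (\<integral>\<^sup>+x. ennreal (gauss_density (x::'a)) \<partial>lborel)"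
    by (subst nn_integral_lborel_affine[of _ "sqrt 2" 0]) (auto simp: G_def)
  then have "(\<integral>\<^sup>+x. ennreal (G x) \<partial>lborel) < \<infinity>"
    by (simp add: nn_integral_gauss_density ennreal_mult_less_top)
  then have "integrable lborel G"
    by (intro integrableI_nonneg) (auto simp: G_def)
  then have "integrable lborel (\<lambda>x. exp (L\<^sup>2) * G x)"
    by simp
  then have "integrable lborel (\<lambda>x::'a. gauss_density x * exp (L * norm x))"
  proof (rule Bochner_Integration.integrable_bound)
    show "AE x::'a in lborel. norm (gauss_density x * exp (L * norm x)) \<le> norm (exp (L\<^sup>2) * G x)"
    proof (rule AE_I2)
      fix x :: 'a
      have "0 \<le> (L - norm x / 2)\<^sup>2" by simp
      then have "- (norm x)\<^sup>2 / 2 + L * norm x \<le> L\<^sup>2 - (norm x)\<^sup>2 / 4"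
        by (simp add: power2_eq_square field_simps)
      then have "exp (- (norm x)\<^sup>2 / 2 + L * norm x) \<le> exp (L\<^sup>2 - (norm x)\<^sup>2 / 4)"
        by simp
      then have "?k * (exp (- (norm x)\<^sup>2 / 2) * exp (L * norm x)) \<le> ?k * (exp (L\<^sup>2) * exp (- (norm x)\<^sup>2 / 4))"
        by (intro mult_left_mono) (auto simp: exp_add[symmetric])
      then show "norm (gauss_density x * exp (L * norm x)) \<le> norm (exp (L\<^sup>2) * G x)"
        by (simp add: G_def gauss_density_def abs_mult power_divide mult_ac)
    qed
  qed auto
  then show ?thesis
    by (subst integrable_gaussian_iff) auto
qed

section \<open>Lipschitz functions and their Gaussian integrability\<close>

lemma lipschitz_real_bound:
  fixes g :: "'a::real_normed_vector \<Rightarrow> real"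
  assumes "L-lipschitz_on UNIV g"
  shows "g (x + y) \<le> g x + L * norm y" "g x \<le> g (x + y) + L * norm y"
    "\<bar>g x\<bar> \<le> \<bar>g 0\<bar> + L * norm x"
proof -
  have *: "\<bar>g a - g b\<bar> \<le> L * norm (a - b)" for a b
    using lipschitz_onD[OF assms, of a b] by (simp add: dist_norm)
  show "g (x + y) \<le> g x + L * norm y" "g x \<le> g (x + y) + L * norm y"
    using *[of "x + y" x] by auto
  show "\<bar>g x\<bar> \<le> \<bar>g 0\<bar> + L * norm x"
    using *[of x 0] by auto
qed

lemma lipschitz_onI_real:
  fixes g :: "'a::real_normed_vector \<Rightarrow> real"
  assumes "\<And>x y. g x \<le> g y + L * norm (x - y)" "0 \<le> L"
  shows "L-lipschitz_on UNIV g"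
proof (rule lipschitz_onI)
  show "dist (g x) (g y) \<le> L * dist x y" for x y
    using assms(1)[of x y] assms(1)[of y x] by (simp add: dist_norm abs_le_iff norm_minus_commute)
qed (fact assms(2))

lemma lipschitz_measurable:
  fixes g :: "'a::euclidean_space \<Rightarrow> real"
  assumes "L-lipschitz_on UNIV g"
  shows "g \<in> borel_measurable borel"
  using assms by (intro borel_measurable_continuous_onI lipschitz_on_continuous_on)

text \<open>The inner map \<open>i\<close> may start from another space: this covers dilations as
  well as the embedding of a line in a given direction.\<close>

lemma lipschitz_affine:
  fixes g :: "'a::real_normed_vector \<Rightarrow> real" and i :: "'b::real_normed_vector \<Rightarrow> 'a"
  assumes "L-lipschitz_on UNIV g" "\<And>a b. norm (i a - i b) \<le> c * norm (a - b)" "0 \<le> c"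
  shows "(L * c)-lipschitz_on UNIV (\<lambda>z. g (x + i z))"
proof (rule lipschitz_onI)
  have L: "0 \<le> L" using assms(1) by (rule lipschitz_on_nonneg)
  show "0 \<le> L * c" using L assms(3) by simp
  fix a b
  have "dist (g (x + i a)) (g (x + i b)) \<le> L * norm (i a - i b)"
    using lipschitz_onD[OF assms(1), of "x + i a" "x + i b"] by (simp add: dist_norm)
  also have "\<dots> \<le> L * (c * norm (a - b))"
    by (intro mult_left_mono assms L)
  finally show "dist (g (x + i a)) (g (x + i b)) \<le> L * c * dist a b"
    by (simp add: dist_norm)
qed

lemma lipschitz_scale:
  fixes g :: "'a::real_normed_vector \<Rightarrow> real"
  assumes "L-lipschitz_on UNIV g"
  shows "(L * \<bar>c\<bar>)-lipschitz_on UNIV (\<lambda>z. g (x + c *\<^sub>R z))"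
  by (rule lipschitz_affine[OF assms]) (auto simp: scaleR_diff_right[symmetric])

lemma gaussian_integrable_exp_lipschitz:
  fixes g :: "'a::euclidean_space \<Rightarrow> real"
  assumes "L-lipschitz_on UNIV g"
  shows "integrable std_gaussian (\<lambda>x. exp (g x))"
proof (rule Bochner_Integration.integrable_bound)
  show "integrable (std_gaussian :: 'a measure) (\<lambda>x. exp \<bar>g 0\<bar> * exp (L * norm x))"
    by (intro integrable_mult_right gaussian_integrable_exp_norm)
  show "(\<lambda>x. exp (g x)) \<in> borel_measurable std_gaussian"
    using lipschitz_measurable[OF assms] by simp
  show "AE x in std_gaussian. norm (exp (g x)) \<le> norm (exp \<bar>g 0\<bar> * exp (L * norm x))"
    using lipschitz_real_bound(3)[OF assms] by (auto simp: exp_add[symmetric] abs_le_iff)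
qed

lemma gaussian_integrable_lipschitz:
  fixes g :: "'a::euclidean_space \<Rightarrow> real"
  assumes "L-lipschitz_on UNIV g"
  shows "integrable std_gaussian g"
proof (rule Bochner_Integration.integrable_bound)
  show "integrable (std_gaussian :: 'a measure) (\<lambda>x. exp \<bar>g 0\<bar> * exp (L * norm x))"
    by (intro integrable_mult_right gaussian_integrable_exp_norm)
  show "g \<in> borel_measurable std_gaussian"
    using lipschitz_measurable[OF assms] by simp
  show "AE x in std_gaussian. norm (g x) \<le> norm (exp \<bar>g 0\<bar> * exp (L * norm x))"
  proof (rule AE_I2)
    fix x
    have "\<bar>g x\<bar> \<le> \<bar>g 0\<bar> + L * norm x" by (rule lipschitz_real_bound[OF assms])
    also have "\<dots> \<le> exp (\<bar>g 0\<bar> + L * norm x)"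
      using exp_ge_add_one_self[of "\<bar>g 0\<bar> + L * norm x"] by linarith
    finally show "norm (g x) \<le> norm (exp \<bar>g 0\<bar> * exp (L * norm x))"
      by (simp add: exp_add)
  qed
qed

section \<open>Logarithms of exponential expectations\<close>

context prob_space
begin

lemma expectation_exp_pos:
  assumes "integrable M (\<lambda>x. exp (u x :: real))"
  shows "0 < expectation (\<lambda>x. exp (u x))"
  using assms by (intro expectation_greater) auto

lemma ln_expectation_exp_mono:
  fixes u v :: "'a \<Rightarrow> real"
  assumes "integrable M (\<lambda>x. exp (u x))" "integrable M (\<lambda>x. exp (v x))"
    and "\<And>x. x \<in> space M \<Longrightarrow> u x \<le> v x + c"
  shows "ln (expectation (\<lambda>x. exp (u x))) \<le> ln (expectation (\<lambda>x. exp (v x))) + c"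
proof -
  have "expectation (\<lambda>x. exp (u x)) \<le> expectation (\<lambda>x. exp c * exp (v x))"
    using assms(1,2) assms(3)[THEN exp_le_cancel_iff[THEN iffD2]]
    by (intro integral_mono) (auto simp: exp_add mult.commute)
  also have "\<dots> = exp c * expectation (\<lambda>x. exp (v x))"
    by simp
  finally have "ln (expectation (\<lambda>x. exp (u x))) \<le> ln (exp c * expectation (\<lambda>x. exp (v x)))"
    using expectation_exp_pos[OF assms(1)] by (subst ln_le_cancel_iff) auto
  also have "\<dots> = c + ln (expectation (\<lambda>x. exp (v x)))"
    using expectation_exp_pos[OF assms(2)] by (simp add: ln_mult)
  finally show ?thesis by simp
qed

text \<open>Jensen's inequality for \<open>exp\<close>, read off from the tangent line at the mean
  \<open>m\<close>: \<open>exp m * (1 + (t - m)) <= exp t\<close>.\<close>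

lemma expectation_le_ln_expectation_exp:
  fixes u :: "'a \<Rightarrow> real"
  assumes "integrable M u" "integrable M (\<lambda>x. exp (u x))"
  shows "expectation u \<le> ln (expectation (\<lambda>x. exp (u x)))"
proof -
  define m where "m = expectation u"
  have "expectation (\<lambda>x. exp m * (1 + (u x - m))) \<le> expectation (\<lambda>x. exp (u x))"
  proof (intro integral_mono)
    fix x
    have "exp m * (1 + (u x - m)) \<le> exp m * exp (u x - m)"
      by (intro mult_left_mono exp_ge_add_one_self) auto
    then show "exp m * (1 + (u x - m)) \<le> exp (u x)"
      by (simp add: exp_diff)
  qed (use assms in auto)
  moreover have "expectation (\<lambda>x. exp m * (1 + (u x - m))) = exp m"
    using assms(1) by (simp add: m_def prob_space)
  ultimately show ?thesis
    using expectation_exp_pos[OF assms(2)] by (simp add: m_def[symmetric] ln_ge_iff)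
qed

end

text \<open>After \<open>y = \<alpha> z + \<beta> w\<close> has replaced \<open>w\<close>,
  completing the square in \<open>z\<close> splits the joint density into a Gaussian factor in
  \<open>y\<close> alone and a multiple of the conditional density of \<open>z\<close> given
  \<open>y\<close>, whose integral is a constant. This is the source of both semigroup laws
  below.\<close>

lemma gaussian_convolution:
  fixes \<alpha> \<beta> :: real
  assumes \<alpha>: "0 < \<alpha>" and \<beta>: "0 < \<beta>"
  defines "c \<equiv> sqrt (\<alpha>\<^sup>2 + \<beta>\<^sup>2)"
  shows "distr (std_gaussian \<Otimes>\<^sub>M std_gaussian) borel (\<lambda>(z, w). \<alpha> *\<^sub>R z + \<beta> *\<^sub>R w)
    = distr (std_gaussian :: 'a::euclidean_space measure) borel (\<lambda>z. c *\<^sub>R z)"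
proof (rule measure_eqI)
  fix A :: "'a set" assume "A \<in> sets (distr (std_gaussian \<Otimes>\<^sub>M std_gaussian) borel (\<lambda>(z, w). \<alpha> *\<^sub>R z + \<beta> *\<^sub>R w))"
  then have A[measurable]: "A \<in> sets borel" by simp
  have cpos: "0 < c" using \<alpha> \<beta> by (simp add: c_def add_pos_pos)
  have c2: "c\<^sup>2 = \<alpha>\<^sup>2 + \<beta>\<^sup>2" by (simp add: c_def)
  let ?g = "\<lambda>x::'a. ennreal (gauss_density x)"
  let ?I = "indicator A :: 'a \<Rightarrow> ennreal"
  let ?n = "DIM('a)"
  \<comment> \<open>Given \<open>y\<close>, the variable \<open>z\<close> is Gaussian with mean
    \<open>(\<alpha>/c\<^sup>2) *\<^sub>R y\<close> and standard deviation
    \<open>\<beta>/c\<close>.\<close>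
  have id: "gauss_density z * gauss_density ((1/\<beta>) *\<^sub>R (y - \<alpha> *\<^sub>R z))
     = gauss_density ((1/c) *\<^sub>R y) * gauss_density ((c/\<beta>) *\<^sub>R (z - (\<alpha>/c\<^sup>2) *\<^sub>R y))" for y z :: 'a
  proof -
    have "(norm z)\<^sup>2 + (norm ((1/\<beta>) *\<^sub>R (y - \<alpha> *\<^sub>R z)))\<^sup>2
      = (norm ((1/c) *\<^sub>R y))\<^sup>2 + (norm ((c/\<beta>) *\<^sub>R (z - (\<alpha>/c\<^sup>2) *\<^sub>R y)))\<^sup>2"
    proof -
      define a b d where "a = z \<bullet> z" and "b = z \<bullet> y" and "d = y \<bullet> y"
      have l: "(norm z)\<^sup>2 + (norm ((1/\<beta>) *\<^sub>R (y - \<alpha> *\<^sub>R z)))\<^sup>2 = a + (d - 2 * \<alpha> * b + \<alpha>\<^sup>2 * a) / \<beta>\<^sup>2"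
        unfolding power2_norm_eq_inner a_def b_def d_def
        by (simp add: inner_diff_left inner_diff_right inner_commute power2_eq_square field_simps
            diff_divide_distrib add_divide_distrib)
      have r: "(norm ((1/c) *\<^sub>R y))\<^sup>2 + (norm ((c/\<beta>) *\<^sub>R (z - (\<alpha>/c\<^sup>2) *\<^sub>R y)))\<^sup>2
          = d / c\<^sup>2 + c\<^sup>2 / \<beta>\<^sup>2 * (a - 2 * (\<alpha> / c\<^sup>2) * b + (\<alpha> / c\<^sup>2)\<^sup>2 * d)"
        unfolding power2_norm_eq_inner a_def b_def d_def
        by (simp add: inner_diff_left inner_diff_right inner_commute power2_eq_square algebra_simps)
      have "d / c\<^sup>2 + c\<^sup>2 / \<beta>\<^sup>2 * (a - 2 * (\<alpha> / c\<^sup>2) * b + (\<alpha> / c\<^sup>2)\<^sup>2 * d)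
         = (c\<^sup>2 * a - 2 * \<alpha> * b + (\<beta>\<^sup>2 + \<alpha>\<^sup>2) / c\<^sup>2 * d) / \<beta>\<^sup>2"
        using \<beta> cpos by (simp add: field_simps power2_eq_square)
      also have "(\<beta>\<^sup>2 + \<alpha>\<^sup>2) / c\<^sup>2 = 1"
        using cpos c2 by (metis add.commute divide_self less_irrefl zero_less_power)
      also have "(c\<^sup>2 * a - 2 * \<alpha> * b + 1 * d) / \<beta>\<^sup>2 = a + (d - 2 * \<alpha> * b + \<alpha>\<^sup>2 * a) / \<beta>\<^sup>2"
        unfolding c2 using \<beta> by (simp add: field_simps)
      finally show ?thesis unfolding l r by simp
    qed
    then have "exp (- (norm z)\<^sup>2 / 2) * exp (- (norm ((1/\<beta>) *\<^sub>R (y - \<alpha> *\<^sub>R z)))\<^sup>2 / 2) =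
      exp (- (norm ((1/c) *\<^sub>R y))\<^sup>2 / 2) * exp (- (norm ((c/\<beta>) *\<^sub>R (z - (\<alpha>/c\<^sup>2) *\<^sub>R y)))\<^sup>2 / 2)"
      unfolding exp_add[symmetric] by (intro arg_cong[of _ _ exp]) argo
    then show ?thesis
      unfolding gauss_density_def by (simp only: mult_ac) (metis (no_types, opaque_lifting) mult.left_commute)
  qed
  have inner: "(\<integral>\<^sup>+z. ?g ((c/\<beta>) *\<^sub>R (z - (\<alpha>/c\<^sup>2) *\<^sub>R y)) \<partial>lborel) = ennreal ((\<beta>/c) ^ ?n)" for y :: 'a
    using \<beta> cpos
    by (subst nn_integral_lborel_affine[of _ "\<beta>/c" "(\<alpha>/c\<^sup>2) *\<^sub>R y"]) (auto simp: nn_integral_gauss_density)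
  have "emeasure (distr (std_gaussian \<Otimes>\<^sub>M std_gaussian) borel (\<lambda>(z, w). \<alpha> *\<^sub>R z + \<beta> *\<^sub>R w)) A
      = (\<integral>\<^sup>+x. ?I (\<alpha> *\<^sub>R fst x + \<beta> *\<^sub>R snd x) \<partial>(std_gaussian \<Otimes>\<^sub>M std_gaussian))"
    by (subst nn_integral_indicator[symmetric], simp, subst nn_integral_distr) (auto simp: case_prod_beta')
  also have "\<dots> = (\<integral>\<^sup>+z. \<integral>\<^sup>+w. ?I (\<alpha> *\<^sub>R z + \<beta> *\<^sub>R w) \<partial>std_gaussian \<partial>std_gaussian)"
    by (subst gaussian.nn_integral_fst[symmetric]) auto
  also have "\<dots> = (\<integral>\<^sup>+z. ?g z * (\<integral>\<^sup>+w. ?g w * ?I (\<alpha> *\<^sub>R z + \<beta> *\<^sub>R w) \<partial>lborel) \<partial>lborel)"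
    by (simp add: nn_integral_gaussian)
  also have "\<dots> = (\<integral>\<^sup>+z. ?g z * (ennreal ((1/\<beta>)^?n) * (\<integral>\<^sup>+y. ?g ((1/\<beta>) *\<^sub>R (y - \<alpha> *\<^sub>R z)) * ?I y \<partial>lborel)) \<partial>lborel)"
  proof (intro nn_integral_cong arg_cong2[where f="(*)"] refl)
    fix z :: 'a
    show "(\<integral>\<^sup>+w. ?g w * ?I (\<alpha> *\<^sub>R z + \<beta> *\<^sub>R w) \<partial>lborel)
      = ennreal ((1/\<beta>)^?n) * (\<integral>\<^sup>+y. ?g ((1/\<beta>) *\<^sub>R (y - \<alpha> *\<^sub>R z)) * ?I y \<partial>lborel)"
      using \<beta> by (subst nn_integral_lborel_affine[of _ "1/\<beta>" "- (\<alpha>/\<beta>) *\<^sub>R z"]) (auto simp: algebra_simps)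
  qed
  also have "\<dots> = (\<integral>\<^sup>+z. \<integral>\<^sup>+y. ennreal ((1/\<beta>)^?n) * ?I y * ennreal (gauss_density z * gauss_density ((1/\<beta>) *\<^sub>R (y - \<alpha> *\<^sub>R z))) \<partial>lborel \<partial>lborel)"
    by (simp add: nn_integral_cmult[symmetric] ennreal_mult' mult_ac)
  also have "\<dots> = (\<integral>\<^sup>+y. \<integral>\<^sup>+z. ennreal ((1/\<beta>)^?n) * ?I y * ennreal (gauss_density z * gauss_density ((1/\<beta>) *\<^sub>R (y - \<alpha> *\<^sub>R z))) \<partial>lborel \<partial>lborel)"
    by (rule lborel_pair.Fubini') measurable
  also have "\<dots> = (\<integral>\<^sup>+y. ennreal ((1/\<beta>)^?n) * ?I y * ?g ((1/c) *\<^sub>R y) * ennreal ((\<beta>/c) ^ ?n) \<partial>lborel)"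
    unfolding id by (simp add: ennreal_mult' nn_integral_cmult inner mult.assoc[symmetric])
  also have "\<dots> = ennreal ((1/c)^?n) * (\<integral>\<^sup>+y. ?g ((1/c) *\<^sub>R y) * ?I y \<partial>lborel)"
  proof -
    have "(1/\<beta>) ^ ?n * (\<beta>/c) ^ ?n = (1/c) ^ ?n"
      using \<beta> by (simp add: power_mult_distrib[symmetric])
    then have "ennreal ((1/\<beta>) ^ ?n) * ennreal ((\<beta>/c) ^ ?n) = ennreal ((1/c) ^ ?n)"
      using \<beta> cpos by (simp flip: ennreal_mult)
    then have "ennreal ((1/\<beta>)^?n) * ?I y * ?g ((1/c) *\<^sub>R y) * ennreal ((\<beta>/c) ^ ?n)
        = ennreal ((1/c)^?n) * (?g ((1/c) *\<^sub>R y) * ?I y)" for y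
      by (metis mult.assoc mult.commute)
    then show ?thesis
      by (simp only: nn_integral_cmult borel_measurable_times_ennreal) (subst nn_integral_cmult, auto)
  qed
  also have "\<dots> = (\<integral>\<^sup>+z. ?g z * ?I (c *\<^sub>R z) \<partial>lborel)"
    using cpos by (subst (2) nn_integral_lborel_affine[of _ "1/c" 0]) auto
  also have "\<dots> = (\<integral>\<^sup>+z. ?I (c *\<^sub>R z) \<partial>std_gaussian)"
    by (simp add: nn_integral_gaussian)
  also have "\<dots> = emeasure (distr std_gaussian borel (\<lambda>z. c *\<^sub>R z)) A"
    by (subst nn_integral_indicator[symmetric], simp, subst nn_integral_distr) auto
  finally show "emeasure (distr (std_gaussian \<Otimes>\<^sub>M std_gaussian) borel (\<lambda>(z, w). \<alpha> *\<^sub>R z + \<beta> *\<^sub>R w)) A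
    = emeasure (distr std_gaussian borel (\<lambda>z. c *\<^sub>R z)) A" .
qed simp

section \<open>Talagrand's transport inequality in dual form\<close>

lemma real_distribution_density:
  assumes [measurable]: "\<rho> \<in> borel_measurable borel"
    and "prob_space (density lborel (\<lambda>x. ennreal (\<rho> x)))"
  shows "real_distribution (density lborel (\<lambda>x. ennreal (\<rho> x)))"
  using assms by (simp add: real_distribution_def real_distribution_axioms_def)

lemma cdf_density_has_derivative:
  fixes \<rho> :: "real \<Rightarrow> real"
  assumes cont: "continuous_on UNIV \<rho>" and nn: "\<And>x. 0 \<le> \<rho> x"
    and pr: "prob_space (density lborel (\<lambda>x. ennreal (\<rho> x)))"
  shows "(cdf (density lborel (\<lambda>x. ennreal (\<rho> x))) has_real_derivative \<rho> x) (at x)"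
proof -
  let ?M = "density lborel (\<lambda>x. ennreal (\<rho> x))"
  have [measurable]: "\<rho> \<in> borel_measurable borel"
    using cont by (rule borel_measurable_continuous_onI)
  interpret real_distribution ?M
    by (rule real_distribution_density) (use pr in auto)
  \<comment> \<open>The base point \<open>x - 1\<close> leaves an integral over a compact interval,
    to which the fundamental theorem of calculus applies near \<open>x\<close>.\<close>
  have cdf: "cdf ?M y = cdf ?M (x - 1) + integral {x - 1..y} \<rho>" if "x - 1 \<le> y" for y
  proof (cases "x - 1 = y")
    case False
    with that have less: "x - 1 < y" by simp
    have c: "continuous_on {x - 1..y} \<rho>"
      using cont by (rule continuous_on_subset) simp
    have I: "0 \<le> integral {x - 1..y} \<rho>"
      by (rule integral_nonneg[OF integrable_continuous_interval[OF c] nn])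
    have "emeasure ?M {x - 1<..y} = (\<integral>\<^sup>+t. ennreal (\<rho> t) * indicator {x - 1<..y} t \<partial>lborel)"
      by (rule emeasure_density) auto
    also have "\<dots> = (\<integral>\<^sup>+t. ennreal (\<rho> t) * indicator {x - 1..y} t \<partial>lborel)"
    proof (rule nn_integral_cong_AE)
      show "AE t in lborel. ennreal (\<rho> t) * indicator {x - 1<..y} t = ennreal (\<rho> t) * indicator {x - 1..y} t"
        using AE_lborel_singleton[of "x - 1"] by eventually_elim (auto simp: indicator_def)
    qed
    also have "\<dots> = ennreal (integral {x - 1..y} \<rho>)"
      by (rule nn_integral_has_integral_lebesgue'[OF nn integrable_integral[OF integrable_continuous_interval[OF c]]])
    finally have "measure ?M {x - 1<..y} = integral {x - 1..y} \<rho>"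
      using I by (simp only: measure_def enn2real_ennreal)
    moreover have "cdf ?M y - cdf ?M (x - 1) = measure ?M {x - 1<..y}"
      by (rule cdf_diff_eq[OF less])
    ultimately show ?thesis by linarith
  qed simp
  have "((\<lambda>y. integral {x - 1..y} \<rho>) has_real_derivative \<rho> x) (at x within {x - 1..x + 1})"
    by (rule integral_has_real_derivative[OF continuous_on_subset[OF cont]]) auto
  then have "((\<lambda>y. integral {x - 1..y} \<rho>) has_real_derivative \<rho> x) (at x)"
    by (subst (asm) at_within_Icc_at) auto
  then have "((\<lambda>y. cdf ?M (x - 1) + integral {x - 1..y} \<rho>) has_real_derivative \<rho> x) (at x)"
    by (auto intro!: derivative_eq_intros)
  then show ?thesis
  proof (rule has_field_derivative_transform_within)
    fix y assume "dist y x < 1"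
    then have "x - 1 \<le> y" by (simp add: dist_real_def abs_less_iff)
    then show "cdf ?M (x - 1) + integral {x - 1..y} \<rho> = cdf ?M y"
      by (rule cdf[symmetric])
  qed auto
qed

text \<open>The map is the inverse of \<open>F\<close> after \<Phi>, for the two distribution
  functions. Positive densities make both strictly increasing, so \<open>F\<close> is a bijection
  onto the open unit interval, and the derivative comes from the inverse function rule and the chain
  rule.\<close>

lemma monotone_transport:
  fixes \<phi> \<rho> :: "real \<Rightarrow> real"
  assumes cont: "continuous_on UNIV \<phi>" "continuous_on UNIV \<rho>"
    and pos: "\<And>x. 0 < \<phi> x" "\<And>x. 0 < \<rho> x"
    and pr: "prob_space (density lborel (\<lambda>x. ennreal (\<phi> x)))" "prob_space (density lborel (\<lambda>x. ennreal (\<rho> x)))"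
  obtains T where
    "\<And>x. cdf (density lborel (\<lambda>x. ennreal (\<rho> x))) (T x) = cdf (density lborel (\<lambda>x. ennreal (\<phi> x))) x"
    "\<And>x. (T has_real_derivative (\<phi> x / \<rho> (T x))) (at x)"
proof -
  let ?N = "density lborel (\<lambda>x. ennreal (\<phi> x))" and ?M = "density lborel (\<lambda>x. ennreal (\<rho> x))"
  define \<Phi> F where "\<Phi> = cdf ?N" and "F = cdf ?M"
  have [measurable]: "\<phi> \<in> borel_measurable borel" "\<rho> \<in> borel_measurable borel"
    using cont by (auto intro: borel_measurable_continuous_onI)
  interpret N: real_distribution ?N
    by (rule real_distribution_density) (use pr in auto)
  interpret M: real_distribution ?M
    by (rule real_distribution_density) (use pr in auto)
  have d\<Phi>: "(\<Phi> has_real_derivative \<phi> x) (at x)" for x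
    unfolding \<Phi>_def using cont pos pr by (intro cdf_density_has_derivative) (auto intro: less_imp_le)
  have dF: "(F has_real_derivative \<rho> x) (at x)" for x
    unfolding F_def using cont pos pr by (intro cdf_density_has_derivative) (auto intro: less_imp_le)
  have mono: "\<Phi> x < \<Phi> y" "F x < F y" if "x < y" for x y
    using DERIV_pos_imp_increasing[OF that] d\<Phi> dF pos by blast+
  have \<Phi>01: "0 < \<Phi> x" "\<Phi> x < 1" for x
    using mono(1)[of "x - 1" x] mono(1)[of x "x + 1"] N.cdf_nonneg[of "x - 1"] N.cdf_bounded_prob[of "x + 1"]
    by (auto simp: \<Phi>_def)
  have contF: "isCont F x" for x
    using dF by (rule DERIV_isCont)
  have ex: "\<exists>y. F y = p" if p: "0 < p" "p < 1" for p
  proof -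
    have "eventually (\<lambda>y. F y < p) at_bot"
      unfolding F_def using order_tendstoD(2)[OF M.cdf_lim_at_bot p(1)] .
    then obtain a where a: "\<And>y. y \<le> a \<Longrightarrow> F y < p" by (auto simp: eventually_at_bot_linorder)
    have "eventually (\<lambda>y. p < F y) at_top"
      unfolding F_def using order_tendstoD(1)[OF M.cdf_lim_at_top_prob p(2)] .
    then obtain b where b: "\<And>y. b \<le> y \<Longrightarrow> p < F y" by (auto simp: eventually_at_top_linorder)
    have "\<exists>y. min a b \<le> y \<and> y \<le> max a b \<and> F y = p"
      using a[of "min a b"] b[of "max a b"] contF by (intro IVT) auto
    then show ?thesis by blast
  qed
  have inj: "inj F"
    by (rule strict_mono_imp_inj_on) (simp add: strict_mono_def mono)
  \<comment> \<open>\<open>inv F\<close> is unspecified off the range of \<open>F\<close>; this is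
    harmless, as \<open>\<Phi> x\<close> lies strictly between 0 and 1.\<close>
  define G where "G = inv F"
  have GF: "G (F y) = y" for y
    unfolding G_def using inj by simp
  have FG: "F (G p) = p" if "0 < p" "p < 1" for p
    using ex[OF that] GF by metis
  define T where "T x = G (\<Phi> x)" for x
  have FT: "F (T x) = \<Phi> x" for x
    unfolding T_def using \<Phi>01 FG by simp
  have "isCont G (F y)" for y
    by (rule isCont_inverse_function[where d = 1]) (auto simp: GF contF)
  then have contG: "isCont G p" if "0 < p" "p < 1" for p
    using ex[OF that] by metis
  have "(T has_real_derivative (\<phi> x / \<rho> (T x))) (at x)" for x
  proof -
    have "(G has_real_derivative inverse (\<rho> (T x))) (at (\<Phi> x))"
      by (rule DERIV_inverse_function[where f = F and a = 0 and b = 1])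
         (use \<Phi>01 dF FG contG pos(2)[of "T x"] in \<open>auto simp: T_def\<close>)
    then have "((\<lambda>x. G (\<Phi> x)) has_real_derivative inverse (\<rho> (T x)) * \<phi> x) (at x)"
      by (rule DERIV_chain2[OF _ d\<Phi>])
    then show ?thesis
      by (simp add: T_def[abs_def] field_simps)
  qed
  with FT show ?thesis
    by (intro that) (auto simp: F_def \<Phi>_def)
qed

lemma density_gaussian_exp:
  fixes g :: "'a::euclidean_space \<Rightarrow> real"
  assumes [measurable]: "g \<in> borel_measurable borel" and "integrable std_gaussian (\<lambda>x. exp (g x))"
  defines "Z \<equiv> \<integral>x. exp (g x) \<partial>std_gaussian"
  shows "prob_space (density lborel (\<lambda>x. ennreal (exp (g x) * gauss_density x / Z)))"
proof
  have Z: "0 < Z" unfolding Z_def using assms(2) by (rule gaussian.expectation_exp_pos)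
  have i: "integrable lborel (\<lambda>x. gauss_density x * exp (g x))"
    using assms(2) by (simp add: integrable_gaussian_iff)
  have eq: "(\<integral>x. gauss_density x * exp (g x) \<partial>lborel) = Z"
    unfolding Z_def by (simp add: integral_gaussian)
  have "(\<integral>\<^sup>+x. ennreal (exp (g x) * gauss_density x / Z) \<partial>lborel)
      = ennreal (\<integral>x. exp (g x) * gauss_density x / Z \<partial>lborel)"
    using i Z by (intro nn_integral_eq_integral) (auto simp: mult.commute)
  also have "(\<integral>x. exp (g x) * gauss_density x / Z \<partial>lborel) = 1"
    using eq Z by (simp add: mult.commute)
  finally show "emeasure (density lborel (\<lambda>x. ennreal (exp (g x) * gauss_density x / Z)))
      (space (density lborel (\<lambda>x. ennreal (exp (g x) * gauss_density x / Z)))) = 1"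
    by (subst emeasure_density) auto
qed

section \<open>The transport inequality on the line\<close>

lemma gauss_density_real: "gauss_density (x::real) = exp (- x\<^sup>2 / 2) / sqrt (2 * pi)"
  by (simp add: gauss_density_def powr_minus_divide powr_half_sqrt)

lemma gauss_density_real_has_derivative:
  "(gauss_density has_real_derivative - x * gauss_density x) (at (x::real))"
proof -
  have "((\<lambda>x. exp (- x\<^sup>2 / 2) / sqrt (2 * pi)) has_real_derivative exp (- x\<^sup>2 / 2) * - x / sqrt (2 * pi)) (at x)"
    by (intro DERIV_cdivide) (auto intro!: derivative_eq_intros)
  then show ?thesis
    by (simp add: gauss_density_real[abs_def] mult.commute)
qed

text \<open>The unit interval next to \<open>x\<close> on the side away from 0 already carries this
  mass, since the density decreases in the absolute value. These lower bounds for Gaussian tails are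
  played against upper bounds for the tails of the transported measure.\<close>

lemma gauss_density_cdf_bounds:
  fixes x :: real
  shows "0 \<le> x \<Longrightarrow> gauss_density (x + 1) \<le> 1 - cdf std_gaussian x"
    and "x \<le> 0 \<Longrightarrow> gauss_density (x - 1) \<le> cdf std_gaussian x"
proof -
  let ?\<Phi> = "cdf (std_gaussian :: real measure)"
  interpret real_distribution "std_gaussian :: real measure"
    by standard auto
  have d: "(?\<Phi> has_real_derivative gauss_density x) (at x)" for x
    unfolding std_gaussian_eq
    by (rule cdf_density_has_derivative)
      (auto intro!: continuous_intros simp: std_gaussian_eq[symmetric] gaussian.prob_space_axioms)
  have mono: "gauss_density b \<le> gauss_density a" if "\<bar>a\<bar> \<le> \<bar>b\<bar>" for a b :: real
    using that by (simp add: gauss_density_def abs_le_square_iff[symmetric])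
  show "gauss_density (x + 1) \<le> 1 - ?\<Phi> x" if "0 \<le> x"
  proof -
    obtain z where "x < z" "z < x + 1" "?\<Phi> (x + 1) - ?\<Phi> x = (x + 1 - x) * gauss_density z"
      using MVT2[of x "x + 1" ?\<Phi> gauss_density] d by auto
    then show ?thesis
      using mono[of z "x + 1"] that cdf_bounded_prob[of "x + 1"] by auto
  qed
  show "gauss_density (x - 1) \<le> ?\<Phi> x" if "x \<le> 0"
  proof -
    obtain z where "x - 1 < z" "z < x" "?\<Phi> x - ?\<Phi> (x - 1) = (x - (x - 1)) * gauss_density z"
      using MVT2[of "x - 1" x ?\<Phi> gauss_density] d by auto
    then show ?thesis
      using mono[of z "x - 1"] that cdf_nonneg[of "x - 1"] by auto
  qed
qed

text \<open>Markov's inequality, applied to \<open>exp t\<close> and to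
  \<open>exp (- t)\<close>.\<close>

lemma real_distribution_cdf_exp_bounds:
  assumes "real_distribution M"
  shows "integrable M exp \<Longrightarrow> 1 - cdf M y \<le> exp (- y) * (\<integral>t. exp t \<partial>M)"
    and "integrable M (\<lambda>t. exp (- t)) \<Longrightarrow> cdf M y \<le> exp y * (\<integral>t. exp (- t) \<partial>M)"
proof -
  interpret real_distribution M by fact
  show "1 - cdf M y \<le> exp (- y) * (\<integral>t. exp t \<partial>M)" if i: "integrable M exp"
  proof -
    have "1 - cdf M y = prob (space M - {..y})"
      unfolding cdf_def by (rule prob_compl[symmetric]) simp
    also have "\<dots> = (\<integral>t. indicator (space M - {..y}) t \<partial>M)"
      by simp
    also have "\<dots> \<le> (\<integral>t. exp (- y) * exp t \<partial>M)"
      using i by (intro integral_mono integrable_mult_right integrable_real_indicator)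
        (auto simp: indicator_def exp_add[symmetric] less_top[symmetric])
    finally show ?thesis by simp
  qed
  show "cdf M y \<le> exp y * (\<integral>t. exp (- t) \<partial>M)" if i: "integrable M (\<lambda>t. exp (- t))"
  proof -
    have "cdf M y = (\<integral>t. indicator {..y} t \<partial>M)"
      unfolding cdf_def by simp
    also have "\<dots> \<le> (\<integral>t. exp y * exp (- t) \<partial>M)"
      using i by (intro integral_mono integrable_mult_right integrable_real_indicator)
        (auto simp: indicator_def exp_add[symmetric] less_top[symmetric])
    finally show ?thesis by simp
  qed
qed

text \<open>Let \<open>T\<close> be the increasing map transporting the Gaussian density \<open>\<phi>\<close> to \<open>e\<^sup>g \<phi> / Z\<close>. The logarithm of
  the change-of-variables identity together with \<open>ln T' \<le> T' - 1\<close> gives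
  \<open>(ln Z - q) \<phi> \<le> ((T - x) \<phi>)'\<close>, and the right-hand side integrates to 0.\<close>

lemma gaussian_transport_real:
  fixes g q :: "real \<Rightarrow> real"
  assumes g: "L-lipschitz_on UNIV g" and q: "C-lipschitz_on UNIV q"
    and gq: "\<And>x u. g (x + u) - u\<^sup>2 / 2 \<le> q x"
  shows "ln (\<integral>x. exp (g x) \<partial>std_gaussian) \<le> (\<integral>x. q x \<partial>std_gaussian)"
proof -
  let ?\<phi> = "gauss_density :: real \<Rightarrow> real"
  have [measurable]: "g \<in> borel_measurable borel" "q \<in> borel_measurable borel"
    using g q by (auto intro: lipschitz_measurable)
  have contg: "continuous_on UNIV g" and contq: "continuous_on UNIV q"
    using g q by (auto intro: lipschitz_on_continuous_on)
  have ig: "integrable std_gaussian (\<lambda>x. exp (g x))"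
    using g by (rule gaussian_integrable_exp_lipschitz)
  define Z where "Z = (\<integral>x. exp (g x) \<partial>std_gaussian)"
  have Z: "0 < Z" unfolding Z_def using ig by (rule gaussian.expectation_exp_pos)
  define \<rho> where "\<rho> x = exp (g x) * ?\<phi> x / Z" for x
  have \<rho>: "0 < \<rho> x" for x using Z by (simp add: \<rho>_def)
  have cont\<rho>: "continuous_on UNIV \<rho>"
    unfolding \<rho>_def by (intro continuous_intros contg) (use Z in auto)
  have [measurable]: "\<rho> \<in> borel_measurable borel"
    using cont\<rho> by (rule borel_measurable_continuous_onI)
  let ?M = "density lborel (\<lambda>x. ennreal (\<rho> x))"
  have pr: "prob_space ?M"
    unfolding \<rho>_def Z_def by (rule density_gaussian_exp) (use ig in auto)
  have M: "real_distribution ?M"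
    by (rule real_distribution_density) (use pr in auto)
  obtain T where cdfT: "\<And>x. cdf ?M (T x) = cdf (std_gaussian :: real measure) x"
    and dT: "\<And>x. (T has_real_derivative (?\<phi> x / \<rho> (T x))) (at x)"
    using monotone_transport[of ?\<phi> \<rho>] cont\<rho> \<rho> pr
    by (auto simp: std_gaussian_eq[symmetric] gaussian.prob_space_axioms continuous_intros)
  define K where "K x = (T x - x) * ?\<phi> x" for x
  define K' where "K' x = (?\<phi> x / \<rho> (T x) - 1) * ?\<phi> x + (T x - x) * (- x * ?\<phi> x)" for x
  have dK: "(K has_real_derivative K' x) (at x)" for x
    unfolding K_def K'_def by (auto intro!: derivative_eq_intros dT gauss_density_real_has_derivative)
  \<comment> \<open>The assumption \<open>gq\<close> is used at \<open>u = T x - x\<close>. The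
    squares of \<open>T x\<close> cancel, and what remains besides \<open>T' - 1\<close> is
    \<open>(T x - x) * (- x)\<close>, the term in \<open>K'\<close> that comes from the derivative
    of the Gaussian density.\<close>
  have key: "(ln Z - q x) * ?\<phi> x \<le> K' x" for x
  proof -
    have ln\<phi>: "ln (?\<phi> y) = - y\<^sup>2 / 2 - ln (sqrt (2 * pi))" for y
      by (simp add: gauss_density_real ln_div)
    have "ln (\<rho> y) = g y + ln (?\<phi> y) - ln Z" for y
      using Z by (simp add: \<rho>_def ln_div ln_mult)
    then have "ln (?\<phi> x / \<rho> (T x)) = ln Z + ((T x)\<^sup>2 / 2 - x\<^sup>2 / 2 - g (T x))"
      using \<rho>[of "T x"] by (simp add: ln_div ln\<phi>)
    moreover have "ln (?\<phi> x / \<rho> (T x)) \<le> ?\<phi> x / \<rho> (T x) - 1"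
      using \<rho> by (intro ln_le_minus_one) auto
    moreover have "g (T x) \<le> q x + (T x - x)\<^sup>2 / 2"
      using gq[of x "T x - x"] by simp
    moreover have "(T x - x)\<^sup>2 / 2 = (T x)\<^sup>2 / 2 - T x * x + x\<^sup>2 / 2"
      by (simp add: power2_eq_square field_simps)
    moreover have "(T x - x) * (- x) = x\<^sup>2 - T x * x"
      by (simp add: power2_eq_square field_simps)
    ultimately have "ln Z - q x \<le> ?\<phi> x / \<rho> (T x) - 1 + (T x - x) * (- x)"
      by linarith
    then have "(ln Z - q x) * ?\<phi> x \<le> (?\<phi> x / \<rho> (T x) - 1 + (T x - x) * (- x)) * ?\<phi> x"
      by (rule mult_right_mono) simp
    also have "\<dots> = K' x" by (simp add: K'_def algebra_simps)
    finally show ?thesis .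
  qed
  define G where "G x = (ln Z - q x) * ?\<phi> x" for x
  have contG: "continuous_on UNIV G"
    unfolding G_def by (intro continuous_intros contq)
  have "integrable std_gaussian (\<lambda>x. ln Z - q x)"
    by (intro Bochner_Integration.integrable_diff gaussian_integrable_lipschitz[OF q]) auto
  then have iG: "integrable lborel G"
    by (simp add: G_def[abs_def] integrable_gaussian_iff mult.commute)
  \<comment> \<open>The pointwise bound is integrated over compact intervals only, by monotonicity
    of \<open>K\<close> minus an antiderivative of \<open>G\<close>; \<open>K'\<close> itself is
    never integrated.\<close>
  have G_le: "integral {- real m..real m} G \<le> K (real m) - K (- real m)" for m
  proof -
    have d: "((\<lambda>x. K x - integral {- real m..x} G) has_real_derivative K' x - G x) (at x within {- real m..real m})"
      if "x \<in> {- real m..real m}" for x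
      using that
      by (intro derivative_intros has_field_derivative_at_within[OF dK]
          integral_has_real_derivative[OF continuous_on_subset[OF contG]]) auto
    have "K (- real m) - integral {- real m..- real m} G \<le> K (real m) - integral {- real m..real m} G"
    proof (rule DERIV_nonneg_imp_increasing_open[where f = "\<lambda>x. K x - integral {- real m..x} G"])
      show "\<exists>y. DERIV (\<lambda>x. K x - integral {- real m..x} G) x :> y \<and> 0 \<le> y" if "- real m < x" "x < real m" for x
        using d[of x] that key[of x] by (auto simp: at_within_Icc_at G_def)
      show "continuous_on {- real m..real m} (\<lambda>x. K x - integral {- real m..x} G)"
        using d by (rule DERIV_continuous_on)
    qed simp
    then show ?thesis by simp
  qed
  have lim: "(\<lambda>m. integral {- real m..real m} G) \<longlonglongrightarrow> (\<integral>x. G x \<partial>lborel)"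
  proof -
    have "(\<lambda>m. \<integral>x. indicator {- real m..real m} x * G x \<partial>lborel) \<longlonglongrightarrow> (\<integral>x. G x \<partial>lborel)"
    proof (rule integral_dominated_convergence[where w = "\<lambda>x. \<bar>G x\<bar>"])
      show "AE x in lborel. (\<lambda>m. indicator {- real m..real m} x * G x) \<longlonglongrightarrow> G x"
      proof (rule AE_I2)
        fix x
        have "eventually (\<lambda>m. \<bar>x\<bar> \<le> real m) sequentially"
          using filterlim_real_sequentially by (auto simp: filterlim_at_top)
        then have "eventually (\<lambda>m. indicator {- real m..real m} x * G x = G x) sequentially"
          by eventually_elim (auto simp: indicator_def)
        then show "(\<lambda>m. indicator {- real m..real m} x * G x) \<longlonglongrightarrow> G x"
          by (rule tendsto_eventually)
      qed
    qed (use iG in \<open>auto simp: indicator_def\<close>)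
    moreover have "(\<integral>x. indicator {- real m..real m} x * G x \<partial>lborel) = integral {- real m..real m} G" for m
    proof -
      have "set_integrable lborel {- real m..real m} G"
        unfolding set_integrable_def using iG by (intro integrable_mult_indicator) auto
      then show ?thesis
        using set_borel_integral_eq_integral(2)[of "{- real m..real m}" G] by (simp add: set_lebesgue_integral_def)
    qed
    ultimately show ?thesis by simp
  qed
  \<comment> \<open>Adding \<open>c * t\<close> to \<open>g\<close> keeps it Lipschitz, so the
    target measure has exponential moments of both signs.\<close>
  have iM: "integrable ?M (\<lambda>t. exp (c * t))" for c
  proof -
    have "(L + \<bar>c\<bar>)-lipschitz_on UNIV (\<lambda>t. g t + c * t)"
      by (intro lipschitz_intros g lipschitz_on_add) (auto intro!: lipschitz_onI simp: dist_real_def abs_mult[symmetric] algebra_simps)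
    from gaussian_integrable_exp_lipschitz[OF this]
    have "integrable lborel (\<lambda>t. ?\<phi> t * exp (g t + c * t) / Z)"
      by (subst (asm) integrable_gaussian_iff) auto
    then show ?thesis
      using \<rho> by (subst integrable_density) (auto simp: \<rho>_def exp_add mult_ac less_imp_le)
  qed
  \<comment> \<open>The Gaussian mass above \<open>x\<close> equals the target mass above
    \<open>T x\<close>. The first is at least the Gaussian density at \<open>x + 1\<close>, the
    second at most \<open>C1 * exp (- T x)\<close>; logarithms show that \<open>T\<close> grows at
    most quadratically.\<close>
  obtain c where upper: "\<And>x. 0 \<le> x \<Longrightarrow> K x \<le> (c + (x + 1)\<^sup>2 / 2 - x) * ?\<phi> x"
  proof -
    define C1 where "C1 = (\<integral>t. exp t \<partial>?M)"
    have C1: "0 < C1" unfolding C1_def using iM[of 1] pr by (intro prob_space.expectation_exp_pos) auto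
    have "T x \<le> (ln C1 + ln (sqrt (2 * pi))) + (x + 1)\<^sup>2 / 2" if "0 \<le> x" for x
    proof -
      have "?\<phi> (x + 1) \<le> exp (- T x) * C1"
        using gauss_density_cdf_bounds(1)[OF that] real_distribution_cdf_exp_bounds(1)[OF M, of "T x"] iM[of 1]
        by (simp add: cdfT C1_def)
      then have "ln (?\<phi> (x + 1)) \<le> ln (exp (- T x) * C1)"
        using C1 by (subst ln_le_cancel_iff) auto
      then show ?thesis
        using C1 by (simp add: ln_mult gauss_density_real ln_div)
    qed
    then show ?thesis
      by (intro that[of "ln C1 + ln (sqrt (2 * pi))"]) (auto simp: K_def add.assoc intro!: mult_right_mono)
  qed
  obtain d where lower: "\<And>x. x \<le> 0 \<Longrightarrow> - K x \<le> (d + (x - 1)\<^sup>2 / 2 + x) * ?\<phi> x"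
  proof -
    define C1 where "C1 = (\<integral>t. exp (- t) \<partial>?M)"
    have C1: "0 < C1" unfolding C1_def using iM[of "- 1"] pr by (intro prob_space.expectation_exp_pos) auto
    have "- T x \<le> (ln C1 + ln (sqrt (2 * pi))) + (x - 1)\<^sup>2 / 2" if "x \<le> 0" for x
    proof -
      have "?\<phi> (x - 1) \<le> exp (T x) * C1"
        using gauss_density_cdf_bounds(2)[OF that] real_distribution_cdf_exp_bounds(2)[OF M, of "T x"] iM[of "- 1"]
        by (simp add: cdfT C1_def)
      then have "ln (?\<phi> (x - 1)) \<le> ln (exp (T x) * C1)"
        using C1 by (subst ln_le_cancel_iff) auto
      then show ?thesis
        using C1 by (simp add: ln_mult gauss_density_real ln_div)
    qed
    then have le: "- (T x - x) \<le> (ln C1 + ln (sqrt (2 * pi))) + (x - 1)\<^sup>2 / 2 + x" if "x \<le> 0" for x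
      using that by fastforce
    have "- K x \<le> ((ln C1 + ln (sqrt (2 * pi))) + (x - 1)\<^sup>2 / 2 + x) * ?\<phi> x" if "x \<le> 0" for x
      using mult_right_mono[OF le[OF that], of "?\<phi> x"] by (simp only: K_def minus_mult_left gauss_density_nonneg)
    then show ?thesis
      by (intro that[of "ln C1 + ln (sqrt (2 * pi))"]) auto
  qed
  \<comment> \<open>The boundary terms are bounded above by quadratic polynomials times the Gaussian
    density, which vanish in the limit.\<close>
  have "(\<integral>x. G x \<partial>lborel) \<le> 0"
  proof (rule LIMSEQ_le[OF lim])
    show "(\<lambda>m. (c + (real m + 1)\<^sup>2 / 2 - real m) * ?\<phi> (real m) + (d + (- real m - 1)\<^sup>2 / 2 + - real m) * ?\<phi> (- real m)) \<longlonglongrightarrow> 0"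
      unfolding gauss_density_real by real_asymp
    show "\<exists>N. \<forall>m\<ge>N. integral {- real m..real m} G \<le> (c + (real m + 1)\<^sup>2 / 2 - real m) * ?\<phi> (real m) + (d + (- real m - 1)\<^sup>2 / 2 + - real m) * ?\<phi> (- real m)"
    proof (intro exI allI impI)
      fix m
      show "integral {- real m..real m} G \<le> (c + (real m + 1)\<^sup>2 / 2 - real m) * ?\<phi> (real m) + (d + (- real m - 1)\<^sup>2 / 2 + - real m) * ?\<phi> (- real m)"
        using G_le[of m] upper[of "real m"] lower[of "- real m"] by simp
    qed
  qed
  moreover have "(\<integral>x. G x \<partial>lborel) = (\<integral>x. ln Z - q x \<partial>std_gaussian)"
    by (simp add: integral_gaussian G_def mult.commute)
  ultimately show ?thesis
    using gaussian_integrable_lipschitz[OF q]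
    by (simp add: Z_def[symmetric])
qed

section \<open>Tensorization over finitely many directions\<close>

lemma lipschitz_gaussian_average:
  fixes q :: "'a::real_normed_vector \<Rightarrow> real" and i :: "'b::euclidean_space \<Rightarrow> 'a"
  assumes q: "C-lipschitz_on UNIV q" and i: "\<And>a b. norm (i a - i b) \<le> c * norm (a - b)" "0 \<le> c"
  shows "C-lipschitz_on UNIV (\<lambda>x. \<integral>z. q (x + i z) \<partial>std_gaussian)"
proof (rule lipschitz_onI_real)
  fix x y
  have int: "integrable std_gaussian (\<lambda>z. q (x + i z))" for x
    by (rule gaussian_integrable_lipschitz[OF lipschitz_affine[OF q i]])
  have "(\<integral>z. q (x + i z) \<partial>std_gaussian) \<le> (\<integral>z. q (y + i z) + C * norm (x - y) \<partial>std_gaussian)"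
  proof (intro integral_mono)
    fix z show "q (x + i z) \<le> q (y + i z) + C * norm (x - y)"
      using lipschitz_real_bound(1)[OF q, of "y + i z" "x - y"] by (simp add: algebra_simps)
  qed (use int in auto)
  then show "(\<integral>z. q (x + i z) \<partial>std_gaussian) \<le> (\<integral>z. q (y + i z) \<partial>std_gaussian) + C * norm (x - y)"
    using int by simp
qed (use q in \<open>rule lipschitz_on_nonneg\<close>)

lemma lipschitz_gaussian_ln_exp:
  fixes g :: "'a::real_normed_vector \<Rightarrow> real" and i :: "'b::euclidean_space \<Rightarrow> 'a"
  assumes g: "L-lipschitz_on UNIV g" and i: "\<And>a b. norm (i a - i b) \<le> c * norm (a - b)" "0 \<le> c"
  shows "L-lipschitz_on UNIV (\<lambda>x. ln (\<integral>z. exp (g (x + i z)) \<partial>std_gaussian))"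
proof (rule lipschitz_onI_real)
  fix x y
  have int: "integrable std_gaussian (\<lambda>z. exp (g (x + i z)))" for x
    by (rule gaussian_integrable_exp_lipschitz[OF lipschitz_affine[OF g i]])
  show "ln (\<integral>z. exp (g (x + i z)) \<partial>std_gaussian) \<le> ln (\<integral>z. exp (g (y + i z)) \<partial>std_gaussian) + L * norm (x - y)"
  proof (rule gaussian.ln_expectation_exp_mono[OF int int])
    fix z show "g (x + i z) \<le> g (y + i z) + L * norm (x - y)"
      using lipschitz_real_bound(1)[OF g, of "y + i z" "x - y"] by (simp add: algebra_simps)
  qed
qed (use g in \<open>rule lipschitz_on_nonneg\<close>)

abbreviation gaussian_PiM :: "'i set \<Rightarrow> ('i \<Rightarrow> real) measure" where
  "gaussian_PiM B \<equiv> PiM B (\<lambda>_. std_gaussian)"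

interpretation gaussian_PiM: product_prob_space "\<lambda>_. std_gaussian :: real measure" B for B :: "'i set"
  by standard

lemma measurable_lincomb [measurable]:
  fixes B :: "'a::euclidean_space set"
  shows "(\<lambda>\<omega>. \<Sum>b\<in>B. \<omega> b *\<^sub>R b) \<in> borel_measurable (gaussian_PiM B)"
proof (rule borel_measurable_sum)
  fix b assume [measurable]: "b \<in> B"
  show "(\<lambda>\<omega>. \<omega> b *\<^sub>R b) \<in> borel_measurable (gaussian_PiM B)"
    by measurable
qed

text \<open>By the triangle inequality the dominating function factorizes into one-dimensional
  exponentials, each of them integrable. \<open>B\<close> is any finite set of vectors, which suits
  the induction on directions.\<close>

lemma integrable_gaussian_PiM_exp_bound:
  fixes B :: "'a::euclidean_space set"
  assumes B: "finite B" and [measurable]: "h \<in> borel_measurable borel"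
    and h: "\<And>x. \<bar>h x\<bar> \<le> exp (a + L * norm x)" and L: "0 \<le> L"
  shows "integrable (gaussian_PiM B) (\<lambda>\<omega>. h (\<Sum>b\<in>B. \<omega> b *\<^sub>R b) :: real)"
proof (rule Bochner_Integration.integrable_bound)
  show "integrable (gaussian_PiM B) (\<lambda>\<omega>. exp a * (\<Prod>b\<in>B. exp (L * norm b * norm (\<omega> b))))"
    by (intro integrable_mult_right gaussian_PiM.product_integrable_prod B gaussian_integrable_exp_norm)
  show "AE \<omega> in gaussian_PiM B. norm (h (\<Sum>b\<in>B. \<omega> b *\<^sub>R b)) \<le> norm (exp a * (\<Prod>b\<in>B. exp (L * norm b * norm (\<omega> b))))"
  proof (rule AE_I2)
    fix \<omega> :: "'a \<Rightarrow> real"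
    have "norm (\<Sum>b\<in>B. \<omega> b *\<^sub>R b) \<le> (\<Sum>b\<in>B. norm b * norm (\<omega> b))"
      by (rule norm_sum[THEN order_trans]) (simp add: mult.commute)
    then have "L * norm (\<Sum>b\<in>B. \<omega> b *\<^sub>R b) \<le> (\<Sum>b\<in>B. L * norm b * norm (\<omega> b))"
      using L by (auto dest: mult_left_mono[of _ _ L] simp: sum_distrib_left mult.assoc)
    then have "exp (a + L * norm (\<Sum>b\<in>B. \<omega> b *\<^sub>R b)) \<le> exp (a + (\<Sum>b\<in>B. L * norm b * norm (\<omega> b)))"
      by simp
    then have "\<bar>h (\<Sum>b\<in>B. \<omega> b *\<^sub>R b)\<bar> \<le> exp (a + (\<Sum>b\<in>B. L * norm b * norm (\<omega> b)))"
      using h[of "\<Sum>b\<in>B. \<omega> b *\<^sub>R b"] by (rule order_trans[rotated])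
    then show "norm (h (\<Sum>b\<in>B. \<omega> b *\<^sub>R b)) \<le> norm (exp a * (\<Prod>b\<in>B. exp (L * norm b * norm (\<omega> b))))"
      using B by (simp add: exp_add exp_sum abs_mult prod_nonneg)
  qed
qed measurable

lemma integrable_gaussian_PiM_lipschitz:
  fixes B :: "'a::euclidean_space set"
  assumes B: "finite B" and q: "C-lipschitz_on UNIV q"
  shows "integrable (gaussian_PiM B) (\<lambda>\<omega>. q (\<Sum>b\<in>B. \<omega> b *\<^sub>R b) :: real)"
    and "integrable (gaussian_PiM B) (\<lambda>\<omega>. exp (q (\<Sum>b\<in>B. \<omega> b *\<^sub>R b)) :: real)"
proof -
  have C: "0 \<le> C" using q by (rule lipschitz_on_nonneg)
  have [measurable]: "q \<in> borel_measurable borel" using q by (rule lipschitz_measurable)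
  have "\<bar>q x\<bar> \<le> exp (\<bar>q 0\<bar> + C * norm x)" for x
    using lipschitz_real_bound(3)[OF q, of x] exp_ge_add_one_self[of "\<bar>q 0\<bar> + C * norm x"] by linarith
  then show "integrable (gaussian_PiM B) (\<lambda>\<omega>. q (\<Sum>b\<in>B. \<omega> b *\<^sub>R b) :: real)"
    by (intro integrable_gaussian_PiM_exp_bound[OF B _ _ C]) auto
  have "\<bar>exp (q x)\<bar> \<le> exp (\<bar>q 0\<bar> + C * norm x)" for x
    using lipschitz_real_bound(3)[OF q, of x] by auto
  then show "integrable (gaussian_PiM B) (\<lambda>\<omega>. exp (q (\<Sum>b\<in>B. \<omega> b *\<^sub>R b)) :: real)"
    by (intro integrable_gaussian_PiM_exp_bound[OF B _ _ C]) auto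
qed

lemma sum_insert_fun_upd:
  fixes i :: "'a::real_vector"
  assumes "finite B" "i \<notin> B"
  shows "(\<Sum>b\<in>insert i B. (fun_upd \<omega> i t) b *\<^sub>R b) = (\<Sum>b\<in>B. \<omega> b *\<^sub>R b) + t *\<^sub>R i"
proof -
  have "(\<Sum>b\<in>B. (fun_upd \<omega> i t) b *\<^sub>R b) = (\<Sum>b\<in>B. \<omega> b *\<^sub>R b)"
    using assms by (intro sum.cong) auto
  with assms show ?thesis by (simp add: add.commute)
qed

text \<open>Induction on the directions. In the new direction \<open>i\<close> the one-dimensional
  inequality is applied with the other coordinates frozen; it yields the hypothesis for
  \<open>G\<close>, the logarithm of the exponential average of \<open>g\<close> along
  \<open>i\<close>, and for \<open>q1\<close>, the average of \<open>q\<close> along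
  \<open>i\<close>. Both keep their Lipschitz constants, and the cost, a sum of squared
  coefficients, splits by coordinates.\<close>

lemma gaussian_transport_PiM:
  fixes B :: "'a::euclidean_space set" and g q :: "'a \<Rightarrow> real"
  assumes "finite B" and "L-lipschitz_on UNIV g" and "C-lipschitz_on UNIV q"
    and "\<And>x c. g (x + (\<Sum>b\<in>B. c b *\<^sub>R b)) - (\<Sum>b\<in>B. (c b)\<^sup>2) / 2 \<le> q x"
  shows "ln (\<integral>\<omega>. exp (g (\<Sum>b\<in>B. \<omega> b *\<^sub>R b)) \<partial>gaussian_PiM B) \<le> (\<integral>\<omega>. q (\<Sum>b\<in>B. \<omega> b *\<^sub>R b) \<partial>gaussian_PiM B)"
  using assms
proof (induction B arbitrary: g q rule: finite_induct)
  case empty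
  have "g 0 \<le> q 0" using empty(3)[of 0] by simp
  have "prob_space (gaussian_PiM ({} :: 'a set))"
    by (intro prob_space_PiM prob_space_std_gaussian)
  with \<open>g 0 \<le> q 0\<close> show ?case by (simp add: prob_space.prob_space)
next
  case (insert i B)
  note g = insert.prems(1) and q = insert.prems(2)
  define G where "G x = ln (\<integral>t. exp (g (x + t *\<^sub>R i)) \<partial>(std_gaussian :: real measure))" for x
  define q1 where "q1 x = (\<integral>t. q (x + t *\<^sub>R i) \<partial>(std_gaussian :: real measure))" for x
  have i: "norm (a *\<^sub>R i - b *\<^sub>R i) \<le> norm i * norm (a - b)" for a b :: real
    by (simp add: scaleR_diff_left[symmetric] mult.commute)
  have "L-lipschitz_on UNIV G"
    unfolding G_def by (rule lipschitz_gaussian_ln_exp[OF g i]) simp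
  moreover have "C-lipschitz_on UNIV q1"
    unfolding q1_def by (rule lipschitz_gaussian_average[OF q i]) simp
  moreover have "G (x + (\<Sum>b\<in>B. c b *\<^sub>R b)) - (\<Sum>b\<in>B. (c b)\<^sup>2) / 2 \<le> q1 x" for x c
  proof -
    let ?y = "x + (\<Sum>b\<in>B. c b *\<^sub>R b)" and ?k = "(\<Sum>b\<in>B. (c b)\<^sup>2) / 2"
    have lg: "(L * norm i)-lipschitz_on UNIV (\<lambda>t. g (?y + t *\<^sub>R i))"
      by (rule lipschitz_affine[OF g i]) simp
    have int: "integrable std_gaussian (\<lambda>t. exp (g (?y + t *\<^sub>R i)))"
      by (rule gaussian_integrable_exp_lipschitz[OF lg])
    \<comment> \<open>The cost \<open>?k\<close> of the other coordinates is constant in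
      \<open>t\<close>; it is put inside the exponential and later leaves the logarithm as a
      summand.\<close>
    have "ln (\<integral>t. exp (g (?y + t *\<^sub>R i) - ?k) \<partial>std_gaussian) \<le> q1 x"
      unfolding q1_def
    proof (rule gaussian_transport_real)
      show "(L * norm i)-lipschitz_on UNIV (\<lambda>t. g (?y + t *\<^sub>R i) - ?k)"
        using lg by (auto simp: lipschitz_on_def dist_real_def)
      show "(C * norm i)-lipschitz_on UNIV (\<lambda>t. q (x + t *\<^sub>R i))"
        by (rule lipschitz_affine[OF q i]) simp
      fix t u :: real
      have "(\<Sum>b\<in>insert i B. (fun_upd c i u b)\<^sup>2) = u\<^sup>2 + (\<Sum>b\<in>B. (c b)\<^sup>2)"
        using insert.hyps by (simp, intro sum.cong) auto
      then show "g (?y + (t + u) *\<^sub>R i) - ?k - u\<^sup>2 / 2 \<le> q (x + t *\<^sub>R i)"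
        using insert.prems(3)[of "x + t *\<^sub>R i" "fun_upd c i u"]
        unfolding sum_insert_fun_upd[OF insert.hyps] by (simp add: algebra_simps add_divide_distrib)
    qed
    also have "(\<integral>t. exp (g (?y + t *\<^sub>R i) - ?k) \<partial>std_gaussian) = (\<integral>t. exp (g (?y + t *\<^sub>R i)) \<partial>std_gaussian) / exp ?k"
      by (simp add: exp_diff)
    also have "ln \<dots> = G ?y - ?k"
      using gaussian.expectation_exp_pos[OF int] by (simp add: G_def ln_div)
    finally show ?thesis .
  qed
  ultimately have IH: "ln (\<integral>\<omega>. exp (G (\<Sum>b\<in>B. \<omega> b *\<^sub>R b)) \<partial>gaussian_PiM B) \<le> (\<integral>\<omega>. q1 (\<Sum>b\<in>B. \<omega> b *\<^sub>R b) \<partial>gaussian_PiM B)"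
    by (rule insert.IH)
  \<comment> \<open>Exponentiating \<open>G\<close> cancels its logarithm, so Fubini's theorem can
    recombine the two integrals into one over \<open>insert i B\<close>.\<close>
  have expG: "exp (G x) = (\<integral>t. exp (g (x + t *\<^sub>R i)) \<partial>std_gaussian)" for x
    unfolding G_def
    using gaussian.expectation_exp_pos[OF gaussian_integrable_exp_lipschitz[OF lipschitz_affine[OF g i], of x]]
    by simp
  have "(\<integral>\<omega>. exp (g (\<Sum>b\<in>insert i B. \<omega> b *\<^sub>R b)) \<partial>gaussian_PiM (insert i B))
      = (\<integral>\<omega>. exp (G (\<Sum>b\<in>B. \<omega> b *\<^sub>R b)) \<partial>gaussian_PiM B)"
    unfolding expG
    by (subst gaussian_PiM.product_integral_insert[OF insert.hyps])
      (use insert.hyps g in \<open>auto intro!: integrable_gaussian_PiM_lipschitz simp del: sum.insert fun_upd_apply simp: sum_insert_fun_upd\<close>)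
  moreover have "(\<integral>\<omega>. q (\<Sum>b\<in>insert i B. \<omega> b *\<^sub>R b) \<partial>gaussian_PiM (insert i B))
      = (\<integral>\<omega>. q1 (\<Sum>b\<in>B. \<omega> b *\<^sub>R b) \<partial>gaussian_PiM B)"
    unfolding q1_def
    by (subst gaussian_PiM.product_integral_insert[OF insert.hyps])
      (use insert.hyps q in \<open>auto intro!: integrable_gaussian_PiM_lipschitz simp del: sum.insert fun_upd_apply simp: sum_insert_fun_upd\<close>)
  ultimately show ?case using IH by simp
qed

section \<open>From the product measure to Euclidean space\<close>

lemma gauss_density_prod: "gauss_density (x::'a::euclidean_space) = (\<Prod>b\<in>Basis. gauss_density (x \<bullet> b))"
proof -
  have "(norm x)\<^sup>2 = (\<Sum>b\<in>Basis. (x \<bullet> b)\<^sup>2)"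
    unfolding power2_norm_eq_inner by (subst euclidean_inner) (simp add: power2_eq_square)
  then have e: "exp (- (norm x)\<^sup>2 / 2) = (\<Prod>b\<in>Basis. exp (- (x \<bullet> b)\<^sup>2 / 2))"
    by (simp add: exp_sum [symmetric] sum_negf sum_divide_distrib)
  have "((2 * pi) powr (- 1 / 2)) ^ DIM('a) = (2 * pi) powr (- real DIM('a) / 2)"
    by (simp add: powr_realpow [symmetric] powr_powr)
  then show ?thesis
    unfolding gauss_density_def e prod.distrib by simp
qed

text \<open>Lebesgue measure is the image of a product of Lebesgue measures under the same
  coordinate map, and a density passes through an image measure. As the Gaussian density factorizes,
  the weighted product agrees with the product of Gaussians on boxes, hence everywhere.\<close>

lemma std_gaussian_eq_distr_PiM:
  "(std_gaussian :: 'a::euclidean_space measure)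
    = distr (gaussian_PiM Basis) borel (\<lambda>\<omega>. \<Sum>b\<in>Basis. \<omega> b *\<^sub>R b)"
proof -
  interpret L: product_sigma_finite "\<lambda>_. lborel :: real measure"
    by standard
  interpret LB: finite_product_sigma_finite "\<lambda>_. lborel :: real measure" "Basis :: 'a set"
    by standard simp
  have [measurable]: "(\<lambda>\<omega>. \<Sum>b\<in>Basis. \<omega> b *\<^sub>R b) \<in> borel_measurable (PiM Basis (\<lambda>_. lborel :: real measure) :: ('a \<Rightarrow> real) measure)"
    by (intro borel_measurable_sum borel_measurable_scaleR) auto
  have P: "density (PiM (Basis :: 'a set) (\<lambda>_. lborel)) (\<lambda>\<omega>. ennreal (gauss_density (\<Sum>b\<in>Basis. \<omega> b *\<^sub>R b)))
     = gaussian_PiM Basis" (is "?P = _")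
  proof (rule gaussian_PiM.PiM_eqI)
    show "sets ?P = sets (gaussian_PiM Basis)"
      by (simp cong: sets_PiM_cong)
    fix A :: "'a \<Rightarrow> real set" assume "\<And>i. i \<in> Basis \<Longrightarrow> A i \<in> sets std_gaussian"
    then have A: "\<And>i. i \<in> Basis \<Longrightarrow> A i \<in> sets borel" by simp
    then have "emeasure ?P (Pi\<^sub>E Basis A)
        = (\<integral>\<^sup>+\<omega>. ennreal (gauss_density (\<Sum>b\<in>Basis. \<omega> b *\<^sub>R b)) * indicator (Pi\<^sub>E Basis A) \<omega> \<partial>PiM Basis (\<lambda>_. lborel))"
      by (intro emeasure_density) (auto intro!: sets_PiM_I_finite)
    also have "\<dots> = (\<integral>\<^sup>+\<omega>. (\<Prod>b\<in>Basis. ennreal (gauss_density (\<omega> b)) * indicator (A b) (\<omega> b)) \<partial>PiM Basis (\<lambda>_. lborel))"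
    proof (rule nn_integral_cong)
      fix \<omega> :: "'a \<Rightarrow> real" assume \<omega>: "\<omega> \<in> space (PiM Basis (\<lambda>_. lborel))"
      have "indicator (Pi\<^sub>E Basis A) \<omega> = (\<Prod>b\<in>Basis. indicator (A b) (\<omega> b) :: ennreal)"
        using \<omega> by (auto simp: indicator_def space_PiM PiE_iff)
      then show "ennreal (gauss_density (\<Sum>b\<in>Basis. \<omega> b *\<^sub>R b)) * indicator (Pi\<^sub>E Basis A) \<omega>
          = (\<Prod>b\<in>Basis. ennreal (gauss_density (\<omega> b)) * indicator (A b) (\<omega> b))"
        by (simp add: gauss_density_prod[of "\<Sum>b\<in>Basis. \<omega> b *\<^sub>R b"] prod_ennreal prod.distrib)
    qed
    also have "\<dots> = (\<Prod>b\<in>(Basis::'a set). \<integral>\<^sup>+t. ennreal (gauss_density t) * indicator (A b) t \<partial>lborel)"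
      using A by (intro L.product_nn_integral_prod) auto
    also have "\<dots> = (\<Prod>b\<in>Basis. emeasure std_gaussian (A b))"
      using A by (intro prod.cong refl) (simp add: std_gaussian_eq emeasure_density)
    finally show "emeasure ?P (Pi\<^sub>E Basis A) = (\<Prod>b\<in>Basis. emeasure std_gaussian (A b))" .
  qed simp
  have "(std_gaussian :: 'a measure) = density (distr (PiM Basis (\<lambda>_. lborel)) borel (\<lambda>\<omega>. \<Sum>b\<in>Basis. \<omega> b *\<^sub>R b)) (\<lambda>x. ennreal (gauss_density x))"
    unfolding std_gaussian_eq by (simp add: lborel_eq[symmetric])
  also have "\<dots> = distr ?P borel (\<lambda>\<omega>. \<Sum>b\<in>Basis. \<omega> b *\<^sub>R b)"
    by (rule density_distr) auto
  finally show ?thesis unfolding P .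
qed

text \<open>The basis is orthonormal, so the sum of squared coefficients is the squared norm.
  \<open>q\<close> may be any Lipschitz majorant of the supremum over \<open>u\<close>, which keeps
  the supremum itself out of the integrals.\<close>

lemma gaussian_transport:
  fixes g q :: "'a::euclidean_space \<Rightarrow> real"
  assumes g: "L-lipschitz_on UNIV g" and q: "C-lipschitz_on UNIV q"
    and gq: "\<And>x u. g (x + u) - (norm u)\<^sup>2 / 2 \<le> q x"
  shows "ln (\<integral>x. exp (g x) \<partial>std_gaussian) \<le> (\<integral>x. q x \<partial>std_gaussian)"
proof -
  have [measurable]: "g \<in> borel_measurable borel" "q \<in> borel_measurable borel"
    using g q by (auto intro: lipschitz_measurable)
  have norm_eq: "(norm (\<Sum>b\<in>Basis. c b *\<^sub>R (b::'a)))\<^sup>2 = (\<Sum>b\<in>Basis. (c b)\<^sup>2)" for c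
    unfolding power2_norm_eq_inner by (subst euclidean_inner) (simp add: power2_eq_square)
  have "ln (\<integral>\<omega>. exp (g (\<Sum>b\<in>Basis. \<omega> b *\<^sub>R b)) \<partial>gaussian_PiM Basis) \<le> (\<integral>\<omega>. q (\<Sum>b\<in>Basis. \<omega> b *\<^sub>R b) \<partial>gaussian_PiM Basis)"
    using gq by (intro gaussian_transport_PiM[OF _ g q]) (auto simp flip: norm_eq)
  then show ?thesis
    unfolding std_gaussian_eq_distr_PiM[where 'a='a] by (simp add: integral_distr)
qed

section \<open>Comparison of Hopf--Cole solutions\<close>

lemma integral_lborel_affine:
  fixes F :: "'a::euclidean_space \<Rightarrow> real"
  assumes [measurable]: "F \<in> borel_measurable borel" and c: "c \<noteq> 0"
  shows "(\<integral>x. F x \<partial>lborel) = \<bar>c\<bar> ^ DIM('a) * (\<integral>x. F (t + c *\<^sub>R x) \<partial>lborel)"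
  by (subst lborel_affine[OF c, of t])
     (simp add: integral_density integral_distr)

lemma lipschitz_on_divide:
  fixes g :: "'a::metric_space \<Rightarrow> real"
  assumes "L-lipschitz_on S g" "0 < \<sigma>"
  shows "(L / \<sigma>)-lipschitz_on S (\<lambda>x. g x / \<sigma>)"
  using assms by (auto simp: lipschitz_on_def dist_real_def diff_divide_distrib[symmetric] divide_right_mono)

lemma integrable_gaussian_norm: "integrable (std_gaussian :: 'a::euclidean_space measure) norm"
  by (rule gaussian_integrable_lipschitz[of 1]) (auto intro!: lipschitz_onI simp: dist_real_def dist_norm norm_triangle_ineq3)

lemma lipschitz_inner_left:
  fixes v :: "'a::real_inner"
  shows "(norm v)-lipschitz_on UNIV (\<lambda>z. z \<bullet> v)"
  using Cauchy_Schwarz_ineq2[of "x - y" v for x y :: 'a]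
  by (intro lipschitz_onI) (auto simp: dist_real_def dist_norm inner_diff_left mult.commute)

text \<open>The density is even and the integrand is odd.\<close>

lemma gaussian_integral_inner: "(\<integral>z. z \<bullet> v \<partial>std_gaussian) = (0 :: real)"
proof -
  have "(\<integral>z. z \<bullet> v \<partial>std_gaussian) = - (\<integral>z. z \<bullet> v \<partial>std_gaussian)"
    unfolding integral_gaussian[of "\<lambda>z. z \<bullet> v", simplified]
    by (subst integral_lborel_affine[of _ "- 1" 0]) (auto simp: gauss_density_def)
  then show ?thesis by simp
qed

text \<open>The Cameron-Martin formula for a constant shift: moving the argument by \<open>v\<close>
  multiplies the density by \<open>exp (- (z \<bullet> v) - (norm v)^2 / 2)\<close>. With this
  factor in the exponent, \<open>u\<close> has the same exponential integral as \<open>g\<close>;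
  Jensen's inequality for \<open>u\<close> is the claim, as the linear term has mean 0.\<close>

lemma gaussian_shift_le_ln_exp:
  fixes g :: "'a::euclidean_space \<Rightarrow> real"
  assumes g: "L-lipschitz_on UNIV g"
  shows "(\<integral>z. g (z + v) \<partial>std_gaussian) - (norm v)\<^sup>2 / 2 \<le> ln (\<integral>z. exp (g z) \<partial>std_gaussian)"
proof -
  have [measurable]: "g \<in> borel_measurable borel" using g by (rule lipschitz_measurable)
  define u where "u z = g (z + v) - z \<bullet> v - (norm v)\<^sup>2 / 2" for z
  have gv: "L-lipschitz_on UNIV (\<lambda>z. g (z + v))"
    using lipschitz_onD[OF g, of "x + v" "y + v" for x y] lipschitz_on_nonneg[OF g]
    by (intro lipschitz_onI) auto
  have "(L + norm v)-lipschitz_on UNIV (\<lambda>z. g (z + v) - z \<bullet> v)"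
    by (intro lipschitz_on_diff gv lipschitz_inner_left)
  then have u: "(L + norm v)-lipschitz_on UNIV u"
    unfolding u_def[abs_def] using lipschitz_on_diff[OF _ lipschitz_on_constant] by fastforce
  have [measurable]: "u \<in> borel_measurable borel" using u by (rule lipschitz_measurable)
  have dens: "gauss_density (v + z) = gauss_density z * exp (- (z \<bullet> v) - (norm v)\<^sup>2 / 2)" for z
  proof -
    have "- (norm (v + z))\<^sup>2 / 2 = - (norm z)\<^sup>2 / 2 + (- (z \<bullet> v) - (norm v)\<^sup>2 / 2)"
      unfolding power2_norm_eq_inner by (simp add: inner_add_left inner_add_right inner_commute field_simps)
    then show ?thesis by (simp only: gauss_density_def exp_add mult.assoc)
  qed
  have exp_u: "exp (u z) = exp (- (z \<bullet> v) - (norm v)\<^sup>2 / 2) * exp (g (v + z))" for z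
    unfolding u_def exp_add[symmetric] by (simp add: algebra_simps)
  have "(\<integral>z. g (z + v) \<partial>std_gaussian) - (norm v)\<^sup>2 / 2 = (\<integral>z. u z \<partial>std_gaussian)"
    using gaussian_integrable_lipschitz[OF gv] gaussian_integrable_lipschitz[OF lipschitz_inner_left, of v] gaussian_integral_inner[of v]
    by (simp add: u_def)
  also have "\<dots> \<le> ln (\<integral>z. exp (u z) \<partial>std_gaussian)"
    by (intro gaussian.expectation_le_ln_expectation_exp gaussian_integrable_lipschitz[OF u]
        gaussian_integrable_exp_lipschitz[OF u])
  also have "(\<integral>z. exp (u z) \<partial>std_gaussian) = (\<integral>z. exp (g z) \<partial>std_gaussian)"
    unfolding integral_gaussian[of "\<lambda>z. exp (g z)", simplified] integral_gaussian[of "\<lambda>z. exp (u z)", simplified]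
    by (subst (2) integral_lborel_affine[of _ 1 v])
       (auto simp: dens exp_u mult.assoc)
  finally show ?thesis .
qed

lemma gaussian_convolution_integral:
  fixes F :: "'a::euclidean_space \<Rightarrow> real"
  assumes s: "0 < s" and t: "0 < t" and [measurable]: "F \<in> borel_measurable borel"
    and int: "integrable std_gaussian (\<lambda>z. F (sqrt (s + t) *\<^sub>R z))"
  shows "(\<integral>z. \<integral>w. F (sqrt s *\<^sub>R z + sqrt t *\<^sub>R w) \<partial>std_gaussian \<partial>std_gaussian)
    = (\<integral>z. F (sqrt (s + t) *\<^sub>R z) \<partial>std_gaussian)"
proof -
  interpret P: pair_prob_space "std_gaussian :: 'a measure" "std_gaussian :: 'a measure" ..
  let ?m = "\<lambda>(z, w). sqrt s *\<^sub>R z + sqrt t *\<^sub>R w :: 'a"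
  have conv: "distr (std_gaussian \<Otimes>\<^sub>M std_gaussian) borel ?m = distr std_gaussian borel (\<lambda>z. sqrt (s + t) *\<^sub>R z)"
    using gaussian_convolution[of "sqrt s" "sqrt t", where 'a = 'a] s t by simp
  have m: "?m \<in> measurable (std_gaussian \<Otimes>\<^sub>M std_gaussian) borel"
    by measurable
  have "integrable (distr (std_gaussian \<Otimes>\<^sub>M std_gaussian) borel ?m) F"
    unfolding conv using int by (subst integrable_distr_eq) auto
  then have i: "integrable (std_gaussian \<Otimes>\<^sub>M std_gaussian) (\<lambda>x. F (?m x))"
    by (subst (asm) integrable_distr_eq[OF m]) auto
  have "(\<integral>z. \<integral>w. F (?m (z, w)) \<partial>std_gaussian \<partial>std_gaussian) = (\<integral>x. F (?m x) \<partial>(std_gaussian \<Otimes>\<^sub>M std_gaussian))"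
    by (rule P.integral_fst'[OF i])
  also have "\<dots> = (\<integral>x. F x \<partial>distr (std_gaussian \<Otimes>\<^sub>M std_gaussian) borel ?m)"
    by (rule integral_distr[OF m, symmetric]) simp
  also have "\<dots> = (\<integral>z. F (sqrt (s + t) *\<^sub>R z) \<partial>std_gaussian)"
    unfolding conv by (rule integral_distr) auto
  finally show ?thesis by simp
qed

section \<open>The heat semigroup of half the Laplacian, and the Hopf-Cole semigroup\<close>

definition heat :: "real \<Rightarrow> ('a::euclidean_space \<Rightarrow> real) \<Rightarrow> 'a \<Rightarrow> real" where
  "heat t h x = (\<integral>z. h (x + sqrt t *\<^sub>R z) \<partial>std_gaussian)"

lemma heat_0 [simp]: "heat 0 h = h"
  by (simp add: heat_def fun_eq_iff)

lemma lipschitz_integrable_shift_scale: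
  fixes h :: "'a::euclidean_space \<Rightarrow> real"
  assumes "C-lipschitz_on UNIV h"
  shows "integrable std_gaussian (\<lambda>z. h (x + c *\<^sub>R z))" "integrable std_gaussian (\<lambda>z. exp (h (x + c *\<^sub>R z)))"
  using lipschitz_scale[OF assms, of c x]
  by (auto intro: gaussian_integrable_lipschitz gaussian_integrable_exp_lipschitz)

lemma heat_lipschitz:
  assumes "C-lipschitz_on UNIV h"
  shows "C-lipschitz_on UNIV (heat t h)"
  unfolding heat_def
  by (rule lipschitz_gaussian_average[OF assms, where c = "\<bar>sqrt t\<bar>"]) (auto simp: scaleR_diff_right[symmetric])

lemma heat_heat:
  assumes h: "C-lipschitz_on UNIV h" and st: "0 \<le> s" "0 \<le> t"
  shows "heat s (heat t h) = heat (s + t) h"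
proof -
  \<comment> \<open>The convolution formula requires positive variances, so zero times are split
    off; there the flow is the identity.\<close>
  consider "s = 0" | "t = 0" | "0 < s" "0 < t" using st by fastforce
  then show ?thesis
  proof cases
    case 3
    have [measurable]: "h \<in> borel_measurable borel" using h by (rule lipschitz_measurable)
    show ?thesis
    proof
      fix x
      show "heat s (heat t h) x = heat (s + t) h x"
        using gaussian_convolution_integral[OF 3, of "\<lambda>y. h (x + y)"] lipschitz_integrable_shift_scale(1)[OF h]
        by (simp add: heat_def add.assoc)
    qed
  qed auto
qed

text \<open>The Hopf--Cole solution at time \<open>t\<close> of
  \<open>w\<^sub>t = \<sigma>/2 \<cdot> \<Delta>w + |\<nabla>w|\<^sup>2/2\<close> with initial value \<open>f\<close>.\<close>

definition hopf_cole :: "real \<Rightarrow> real \<Rightarrow> ('a::euclidean_space \<Rightarrow> real) \<Rightarrow> 'a \<Rightarrow> real" where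
  "hopf_cole \<sigma> t f x = \<sigma> * ln (\<integral>z. exp (f (x + sqrt (\<sigma> * t) *\<^sub>R z) / \<sigma>) \<partial>std_gaussian)"

lemma hopf_cole_0: "0 < \<sigma> \<Longrightarrow> hopf_cole \<sigma> 0 f = f"
  by (simp add: hopf_cole_def fun_eq_iff)

lemma hopf_cole_lipschitz:
  assumes f: "L-lipschitz_on UNIV f" and \<sigma>: "0 < \<sigma>"
  shows "L-lipschitz_on UNIV (hopf_cole \<sigma> t f)"
proof -
  have "(L / \<sigma>)-lipschitz_on UNIV (\<lambda>x. ln (\<integral>z. exp (f (x + sqrt (\<sigma> * t) *\<^sub>R z) / \<sigma>) \<partial>std_gaussian))"
    by (rule lipschitz_gaussian_ln_exp[OF lipschitz_on_divide[OF f \<sigma>], where c = "\<bar>sqrt (\<sigma> * t)\<bar>"])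
      (auto simp: scaleR_diff_right[symmetric])
  from lipschitz_on_divide[OF this, of "1 / \<sigma>"] show ?thesis
    using \<sigma> by (simp add: hopf_cole_def[abs_def] mult.commute)
qed

text \<open>Under the substitution \<open>exp (w / \<sigma>)\<close> the operator becomes Gaussian
  averaging of variance \<open>\<sigma> * t\<close>, and variances add.\<close>

lemma hopf_cole_hopf_cole:
  assumes f: "L-lipschitz_on UNIV f" and \<sigma>: "0 < \<sigma>" and st: "0 \<le> s" "0 \<le> t"
  shows "hopf_cole \<sigma> s (hopf_cole \<sigma> t f) = hopf_cole \<sigma> (s + t) f"
proof -
  consider "s = 0" | "t = 0" | "0 < s" "0 < t" using st by fastforce
  then show ?thesis
  proof cases
    case 3
    have f\<sigma>: "(L / \<sigma>)-lipschitz_on UNIV (\<lambda>x. f x / \<sigma>)"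
      using f \<sigma> by (rule lipschitz_on_divide)
    have [measurable]: "f \<in> borel_measurable borel" using f by (rule lipschitz_measurable)
    show ?thesis
    proof
      fix x
      have int: "integrable std_gaussian (\<lambda>w. exp (f (y + c *\<^sub>R w) / \<sigma>))" for y c
        using lipschitz_integrable_shift_scale(2)[OF f\<sigma>] .
      have "exp (hopf_cole \<sigma> t f y / \<sigma>) = (\<integral>w. exp (f (y + sqrt (\<sigma> * t) *\<^sub>R w) / \<sigma>) \<partial>std_gaussian)" for y
        using gaussian.expectation_exp_pos[OF int] \<sigma> by (simp add: hopf_cole_def)
      then have "hopf_cole \<sigma> s (hopf_cole \<sigma> t f) x = \<sigma> * ln (\<integral>z. \<integral>w. exp (f (x + (sqrt (\<sigma> * s) *\<^sub>R z + sqrt (\<sigma> * t) *\<^sub>R w)) / \<sigma>) \<partial>std_gaussian \<partial>std_gaussian)"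
        by (simp add: hopf_cole_def[of \<sigma> s] add.assoc)
      also have "\<dots> = hopf_cole \<sigma> (s + t) f x"
        using 3 \<sigma> int
        by (subst gaussian_convolution_integral[of "\<sigma> * s" "\<sigma> * t" "\<lambda>y. exp (f (x + y) / \<sigma>)"])
          (auto simp: hopf_cole_def distrib_left)
      finally show "hopf_cole \<sigma> s (hopf_cole \<sigma> t f) x = hopf_cole \<sigma> (s + t) f x" .
    qed
  qed (use \<sigma> in \<open>auto simp: hopf_cole_0\<close>)
qed

text \<open>A control that is constant over one time step: the displacement
  \<open>sqrt \<delta> *\<^sub>R v\<close> in time \<delta> costs its squared norm over
  \<open>2 * \<delta>\<close>, which in this scaling is free of \<delta>.\<close>

lemma hopf_cole_ge_shifted_heat:
  assumes f: "L-lipschitz_on UNIV f" and \<delta>: "0 < \<delta>"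
  shows "heat \<delta> f (x + sqrt \<delta> *\<^sub>R v) - (norm v)\<^sup>2 / 2 \<le> hopf_cole 1 \<delta> f x"
  using gaussian_shift_le_ln_exp[OF lipschitz_scale[OF f], of x "sqrt \<delta>" v] \<delta>
  by (simp add: heat_def hopf_cole_def algebra_simps)

text \<open>A Lipschitz function changes by at most \<open>L * sqrt \<delta> * norm z\<close> under
  the Gaussian displacement. The bound \<epsilon> is the price of one averaging step and tends to 0
  with \<delta>.\<close>

lemma heat_close:
  fixes f :: "'a::euclidean_space \<Rightarrow> real"
  assumes f: "L-lipschitz_on UNIV f" and "0 \<le> \<delta>"
  defines "\<epsilon> \<equiv> L * sqrt \<delta> * (\<integral>z. norm z \<partial>(std_gaussian :: 'a measure))"
  shows "f x \<le> heat \<delta> f x + \<epsilon>" "heat \<delta> f x \<le> f x + \<epsilon>"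
proof -
  have int: "integrable std_gaussian (\<lambda>z. f (x + sqrt \<delta> *\<^sub>R z))"
    by (rule lipschitz_integrable_shift_scale(1)[OF f])
  have eps: "\<epsilon> = (\<integral>z. L * norm (sqrt \<delta> *\<^sub>R z) \<partial>(std_gaussian :: 'a measure))"
    using assms(2) by (simp add: \<epsilon>_def)
  have intn: "integrable (std_gaussian :: 'a measure) (\<lambda>z. L * norm (sqrt \<delta> *\<^sub>R z))"
    by (simp add: integrable_gaussian_norm)
  have "(\<integral>z. f x \<partial>(std_gaussian :: 'a measure)) \<le> (\<integral>z. f (x + sqrt \<delta> *\<^sub>R z) + L * norm (sqrt \<delta> *\<^sub>R z) \<partial>std_gaussian)"
    by (intro integral_mono) (use int intn lipschitz_real_bound(2)[OF f] in \<open>auto simp del: norm_scaleR\<close>)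
  then show "f x \<le> heat \<delta> f x + \<epsilon>"
    using int intn unfolding eps heat_def by (subst (asm) Bochner_Integration.integral_add) auto
  have "(\<integral>z. f (x + sqrt \<delta> *\<^sub>R z) \<partial>std_gaussian) \<le> (\<integral>z. f x + L * norm (sqrt \<delta> *\<^sub>R z) \<partial>(std_gaussian :: 'a measure))"
    by (intro integral_mono) (use int intn lipschitz_real_bound(1)[OF f] in \<open>auto simp del: norm_scaleR\<close>)
  then show "heat \<delta> f x \<le> f x + \<epsilon>"
    using int intn unfolding eps heat_def by (subst (asm) Bochner_Integration.integral_add) auto
qed

text \<open>The induction step in time, with the same \<epsilon> before and after. On the left, the
  transport inequality admits shifts \<open>u\<close> that depend on the noise \<open>z\<close>. The
  averaging \<open>heat \<delta> b\<close> in the hypothesis absorbs such a shift: it averages over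
  fresh noise at a point already displaced, hence is at most \<open>hopf_cole 1 \<delta> b\<close>
  plus the cost. The noise \<open>z\<close> is averaged last and reappears as the outer
  \<open>heat \<delta>\<close>.\<close>

lemma hopf_cole_step_comparison:
  fixes a b h :: "'a::euclidean_space \<Rightarrow> real"
  assumes a: "L-lipschitz_on UNIV a" and b: "L-lipschitz_on UNIV b" and h: "C-lipschitz_on UNIV h"
    and \<kappa>: "0 < \<kappa>" and \<delta>: "0 < \<delta>"
    and ab: "\<And>x y. a (x + (\<kappa> - 1) *\<^sub>R y) \<le> heat \<delta> b x + h y + \<epsilon>"
  shows "hopf_cole (\<kappa>\<^sup>2) \<delta> a (x + (\<kappa> - 1) *\<^sub>R y) \<le> heat \<delta> (hopf_cole 1 \<delta> b) x + heat \<delta> h y + \<epsilon>"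
proof -
  let ?b = "hopf_cole 1 \<delta> b" and ?s = "sqrt \<delta>" and ?\<sigma> = "\<kappa>\<^sup>2"
  let ?g = "\<lambda>z. a ((x + (\<kappa> - 1) *\<^sub>R y) + (\<kappa> * ?s) *\<^sub>R z) / ?\<sigma>"
  let ?q = "\<lambda>z. (?b (x + ?s *\<^sub>R z) + h (y + ?s *\<^sub>R z) + \<epsilon>) / ?\<sigma>"
  have \<sigma>: "0 < ?\<sigma>" using \<kappa> by simp
  have lb: "L-lipschitz_on UNIV ?b" using b by (rule hopf_cole_lipschitz) simp
  have g: "(L * \<bar>\<kappa> * ?s\<bar> / ?\<sigma>)-lipschitz_on UNIV ?g"
    by (intro lipschitz_on_divide lipschitz_scale a \<sigma>)
  have "(L * \<bar>?s\<bar> + C * \<bar>?s\<bar>)-lipschitz_on UNIV (\<lambda>z. ?b (x + ?s *\<^sub>R z) + h (y + ?s *\<^sub>R z))"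
    by (intro lipschitz_on_add lipschitz_scale lb h)
  then have "(L * \<bar>?s\<bar> + C * \<bar>?s\<bar>)-lipschitz_on UNIV (\<lambda>z. ?b (x + ?s *\<^sub>R z) + h (y + ?s *\<^sub>R z) + \<epsilon>)"
    by (auto simp: lipschitz_on_def dist_real_def)
  then have q: "((L * \<bar>?s\<bar> + C * \<bar>?s\<bar>) / ?\<sigma>)-lipschitz_on UNIV ?q"
    using \<sigma> by (rule lipschitz_on_divide)
  have "ln (\<integral>z. exp (?g z) \<partial>std_gaussian) \<le> (\<integral>z. ?q z \<partial>std_gaussian)"
  proof (rule gaussian_transport[OF g q])
    fix z u :: 'a
    \<comment> \<open>The noise \<open>\<kappa> *\<^sub>R z\<close> is split as
      \<open>z + (\<kappa> - 1) *\<^sub>R z\<close>, so that the same \<open>z\<close> moves both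
      \<open>x\<close> and \<open>y\<close>; the shift \<open>u\<close> moves \<open>x\<close>
      alone.\<close>
    have "a ((x + (\<kappa> - 1) *\<^sub>R y) + (\<kappa> * ?s) *\<^sub>R (z + u))
        = a ((x + ?s *\<^sub>R z + ?s *\<^sub>R (\<kappa> *\<^sub>R u)) + (\<kappa> - 1) *\<^sub>R (y + ?s *\<^sub>R z))"
      by (simp add: algebra_simps)
    also have "\<dots> \<le> heat \<delta> b (x + ?s *\<^sub>R z + ?s *\<^sub>R (\<kappa> *\<^sub>R u)) + h (y + ?s *\<^sub>R z) + \<epsilon>"
      by (rule ab)
    \<comment> \<open>The control \<open>\<kappa> *\<^sub>R u\<close> costs
      \<open>?\<sigma> * (norm u)^2 / 2\<close>; division by \<open>?\<sigma>\<close> turns this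
      into the cost in the transport inequality.\<close>
    also have "\<dots> \<le> ?b (x + ?s *\<^sub>R z) + ?\<sigma> * ((norm u)\<^sup>2 / 2) + h (y + ?s *\<^sub>R z) + \<epsilon>"
      using hopf_cole_ge_shifted_heat[OF b \<delta>, of "x + ?s *\<^sub>R z" "\<kappa> *\<^sub>R u"] by (simp add: power_mult_distrib)
    finally have "a ((x + (\<kappa> - 1) *\<^sub>R y) + (\<kappa> * ?s) *\<^sub>R (z + u)) / ?\<sigma>
        \<le> (?b (x + ?s *\<^sub>R z) + ?\<sigma> * ((norm u)\<^sup>2 / 2) + h (y + ?s *\<^sub>R z) + \<epsilon>) / ?\<sigma>"
      using \<sigma> by (intro divide_right_mono) auto
    also have "\<dots> = ?q z + (norm u)\<^sup>2 / 2"
      using \<sigma> by (simp add: add_divide_distrib)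
    finally show "?g (z + u) - (norm u)\<^sup>2 / 2 \<le> ?q z" by simp
  qed
  then have "?\<sigma> * ln (\<integral>z. exp (?g z) \<partial>std_gaussian) \<le> ?\<sigma> * (\<integral>z. ?q z \<partial>std_gaussian)"
    using \<sigma> by (intro mult_left_mono) auto
  also have "\<dots> = heat \<delta> ?b x + heat \<delta> h y + \<epsilon>"
    using \<sigma> lipschitz_integrable_shift_scale(1)[OF lb] lipschitz_integrable_shift_scale(1)[OF h]
    by (simp add: heat_def)
  also have "?\<sigma> * ln (\<integral>z. exp (?g z) \<partial>std_gaussian) = hopf_cole ?\<sigma> \<delta> a (x + (\<kappa> - 1) *\<^sub>R y)"
    using \<kappa> by (simp add: hopf_cole_def real_sqrt_mult)
  finally show ?thesis .
qed

text \<open>The step is iterated with step length \<delta>, and then the partition of the unit time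
  interval is refined. An extra \<open>heat \<delta>\<close> is inserted at time 0 and removed at
  time 1; these are the only two errors, and both vanish with \<delta>.\<close>

lemma hopf_cole_comparison:
  fixes f h :: "'a::euclidean_space \<Rightarrow> real"
  assumes f: "L-lipschitz_on UNIV f" and h: "C-lipschitz_on UNIV h" and \<kappa>: "0 < \<kappa>"
    and fh: "\<And>x y. f (x + (\<kappa> - 1) *\<^sub>R y) \<le> f x + h y"
  shows "hopf_cole (\<kappa>\<^sup>2) 1 f 0 \<le> hopf_cole 1 1 f 0 + heat 1 h 0"
proof -
  let ?\<sigma> = "\<kappa>\<^sup>2" and ?m = "\<integral>z. norm z \<partial>(std_gaussian :: 'a measure)"
  have \<sigma>: "0 < ?\<sigma>" using \<kappa> by simp
  have step: "hopf_cole ?\<sigma> (real k * \<delta>) f (x + (\<kappa> - 1) *\<^sub>R y)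
      \<le> heat \<delta> (hopf_cole 1 (real k * \<delta>) f) x + heat (real k * \<delta>) h y + L * sqrt \<delta> * ?m"
    if \<delta>: "0 < \<delta>" for k \<delta> x y
  proof (induction k arbitrary: x y)
    case 0
    show ?case
      using fh[of x y] heat_close(1)[OF f, of \<delta> x] \<delta> \<sigma> by (simp add: hopf_cole_0)
  next
    case (Suc k)
    have t: "0 \<le> real k * \<delta>" using \<delta> by simp
    have e: "\<delta> + real k * \<delta> = real (Suc k) * \<delta>" by (simp add: algebra_simps)
    have "hopf_cole ?\<sigma> \<delta> (hopf_cole ?\<sigma> (real k * \<delta>) f) (x + (\<kappa> - 1) *\<^sub>R y)
        \<le> heat \<delta> (hopf_cole 1 \<delta> (hopf_cole 1 (real k * \<delta>) f)) x + heat \<delta> (heat (real k * \<delta>) h) y + L * sqrt \<delta> * ?m"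
      using hopf_cole_lipschitz[OF f \<sigma>] hopf_cole_lipschitz[OF f, of 1] heat_lipschitz[OF h] \<kappa> \<delta> Suc.IH
      by (intro hopf_cole_step_comparison) auto
    then show ?case
      using hopf_cole_hopf_cole[OF f \<sigma> less_imp_le[OF \<delta>] t] hopf_cole_hopf_cole[OF f _ less_imp_le[OF \<delta>] t, of 1]
        heat_heat[OF h less_imp_le[OF \<delta>] t]
      by (simp only: e zero_less_one simp_thms)
  qed
  \<comment> \<open>\<open>Suc n\<close> steps of length \<open>1 / Suc n\<close>, evaluated at
    \<open>x = y = 0\<close>.\<close>
  have bound: "hopf_cole ?\<sigma> 1 f 0 \<le> hopf_cole 1 1 f 0 + heat 1 h 0 + 2 * L * ?m * sqrt (1 / real (Suc n))" for n
  proof -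
    let ?\<delta> = "1 / real (Suc n)"
    have "hopf_cole ?\<sigma> 1 f 0 \<le> heat ?\<delta> (hopf_cole 1 1 f) 0 + heat 1 h 0 + L * sqrt ?\<delta> * ?m"
      using step[of ?\<delta> "Suc n" 0 0] by simp
    also have "heat ?\<delta> (hopf_cole 1 1 f) 0 \<le> hopf_cole 1 1 f 0 + L * sqrt ?\<delta> * ?m"
      by (rule heat_close(2)[OF hopf_cole_lipschitz[OF f]]) auto
    finally show ?thesis by (simp add: algebra_simps)
  qed
  have lim: "(\<lambda>n. hopf_cole 1 1 f 0 + heat 1 h 0 + 2 * L * ?m * sqrt (1 / real (Suc n))) \<longlonglongrightarrow> hopf_cole 1 1 f 0 + heat 1 h 0 + 2 * L * ?m * 0"
    by (intro tendsto_intros) real_asymp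
  have "hopf_cole ?\<sigma> 1 f 0 \<le> hopf_cole 1 1 f 0 + heat 1 h 0 + 2 * L * ?m * 0"
    by (rule LIMSEQ_le_const[OF lim]) (use bound in blast)
  then show ?thesis by simp
qed

section \<open>The reverse logarithmic Sobolev inequality\<close>

lemma convex_full_measure_eq_UNIV:
  fixes A :: "'a::euclidean_space set"
  assumes A: "convex A" and ae: "AE x in lborel. x \<in> A"
  shows "A = UNIV"
proof -
  have "AE x in lebesgue. x \<in> closure A"
    by (rule AE_completion) (use ae closure_subset in fastforce)
  then have "closure A = UNIV"
    using mem_closed_if_AE_lebesgue[OF closed_closure, of A] by blast
  \<comment> \<open>A convex set has the same relative interior as its closure, so a dense convex
    set is the whole space.\<close>
  then have "rel_interior A = UNIV"
    using convex_rel_interior_closure[OF A] rel_interior_UNIV by metis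
  then show ?thesis
    using rel_interior_subset[of A] by auto
qed

text \<open>The set \<open>A\<close> of directions in which \<open>K\<close> is bounded above is
  convex and has full measure, so it contains every vector. The directions \<open>b\<close> and
  \<open>- b\<close> for basis vectors \<open>b\<close> then bound all coordinates of
  \<open>K\<close>.\<close>

lemma bounded_if_support_fun_finite:
  fixes K :: "'a::euclidean_space set"
  assumes fin: "AE y in lborel. support_fun K y < \<infinity>"
  shows "bounded K"
proof -
  define A where "A = {y. \<exists>M. \<forall>t\<in>K. y \<bullet> t \<le> M}"
  have "convex A"
  proof (rule convexI)
    fix x y :: 'a and u v :: real
    assume "x \<in> A" "y \<in> A" and uv: "0 \<le> u" "0 \<le> v"
    then obtain M N where "\<And>t. t \<in> K \<Longrightarrow> x \<bullet> t \<le> M" "\<And>t. t \<in> K \<Longrightarrow> y \<bullet> t \<le> N"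
      by (auto simp: A_def)
    then have "(u *\<^sub>R x + v *\<^sub>R y) \<bullet> t \<le> u * M + v * N" if "t \<in> K" for t
      using that uv by (auto simp: inner_add_left intro!: add_mono mult_left_mono)
    then show "u *\<^sub>R x + v *\<^sub>R y \<in> A" by (auto simp: A_def)
  qed
  moreover from fin have "AE y in lborel. y \<in> A"
  proof eventually_elim
    fix y :: 'a assume y: "support_fun K y < \<infinity>"
    have "y \<bullet> t \<le> real_of_ereal (support_fun K y)" if "t \<in> K" for t
    proof -
      have "ereal (y \<bullet> t) \<le> support_fun K y"
        unfolding support_fun_def using that by (rule SUP_upper)
      with y show ?thesis by (cases "support_fun K y") auto
    qed
    then show "y \<in> A" by (auto simp: A_def)
  qed
  ultimately have "A = UNIV" by (rule convex_full_measure_eq_UNIV)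
  then have "\<forall>y. \<exists>M. \<forall>t\<in>K. y \<bullet> t \<le> M" by (auto simp: A_def)
  then obtain M where M: "\<And>y t. t \<in> K \<Longrightarrow> y \<bullet> t \<le> M y" by metis
  have "norm t \<le> (\<Sum>b\<in>Basis. max (M b) (M (- b)))" if "t \<in> K" for t
  proof -
    have "norm t \<le> (\<Sum>b\<in>Basis. \<bar>t \<bullet> b\<bar>)" by (rule norm_le_l1)
    also have "\<dots> \<le> (\<Sum>b\<in>Basis. max (M b) (M (- b)))"
    proof (rule sum_mono)
      fix b :: 'a
      show "\<bar>t \<bullet> b\<bar> \<le> max (M b) (M (- b))"
        using M[OF that, of b] M[OF that, of "- b"] by (auto simp: abs_le_iff inner_commute)
    qed
    finally show ?thesis .
  qed
  then show ?thesis by (auto simp: bounded_iff)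
qed

lemma AE_gaussian_iff:
  fixes P :: "'a::euclidean_space \<Rightarrow> bool"
  shows "(AE x in std_gaussian. P x) \<longleftrightarrow> (AE x in lborel. P x)"
  unfolding std_gaussian_eq by (subst AE_density) auto

lemma ereal_integrable_imp_bounded:
  fixes K :: "'a::euclidean_space set"
  assumes "ereal_integrable std_gaussian (support_fun K)"
  shows "bounded K"
proof (rule bounded_if_support_fun_finite)
  have "AE y in std_gaussian. e2ennreal \<bar>support_fun K y\<bar> \<noteq> \<infinity>"
    using assms unfolding ereal_integrable_def
    by (intro nn_integral_noteq_infinite) auto
  \<comment> \<open>The Gaussian density is positive, so its null sets are those of Lebesgue
    measure.\<close>
  then have "AE y in lborel. e2ennreal \<bar>support_fun K y\<bar> \<noteq> \<infinity>"
    by (simp only: AE_gaussian_iff)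
  then show "AE y in lborel. support_fun K y < \<infinity>"
    by eventually_elim (auto simp: less_top[symmetric] top_ereal_def e2ennreal_infty)
qed

lemma support_fun_bounded:
  fixes K :: "'a::euclidean_space set"
  assumes K: "K \<noteq> {}" "\<And>t. t \<in> K \<Longrightarrow> norm t \<le> L"
  defines "h \<equiv> \<lambda>y. real_of_ereal (support_fun K y)"
  shows "L-lipschitz_on UNIV h" and "t \<in> K \<Longrightarrow> y \<bullet> t \<le> h y" and "0 \<le> c \<Longrightarrow> h (c *\<^sub>R y) \<le> c * h y"
proof -
  have L: "0 \<le> L" using K norm_ge_zero by (metis all_not_in_conv order_trans)
  have le: "y \<bullet> t \<le> L * norm y" if "t \<in> K" for y t
    using Cauchy_Schwarz_ineq2[of y t] mult_left_mono[OF K(2)[OF that], of "norm y"] by (simp add: mult.commute)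
  \<comment> \<open>A point of \<open>K\<close> rules out the value \<open>- \<infinity>\<close> and
    the bound \<open>L\<close> the value \<open>\<infinity>\<close>, so passing to real numbers
    loses nothing.\<close>
  have fin: "\<bar>support_fun K y\<bar> \<noteq> \<infinity>" for y
  proof -
    obtain t where t: "t \<in> K" using K by auto
    have "ereal (y \<bullet> t) \<le> support_fun K y"
      unfolding support_fun_def using t by (rule SUP_upper)
    moreover have "support_fun K y \<le> ereal (L * norm y)"
      unfolding support_fun_def using le by (intro SUP_least) auto
    ultimately show ?thesis by (cases "support_fun K y") auto
  qed
  have h: "support_fun K y = ereal (h y)" for y
    using fin[of y] by (simp add: h_def ereal_real)
  have ge: "y \<bullet> t \<le> h y" if "t \<in> K" for y t
  proof -
    have "ereal (y \<bullet> t) \<le> support_fun K y"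
      unfolding support_fun_def using that by (rule SUP_upper)
    then show ?thesis by (simp add: h)
  qed
  have least: "h y \<le> M" if "\<And>t. t \<in> K \<Longrightarrow> y \<bullet> t \<le> M" for y M
  proof -
    have "support_fun K y \<le> ereal M"
      unfolding support_fun_def using that by (intro SUP_least) auto
    then show ?thesis by (simp add: h)
  qed
  show "t \<in> K \<Longrightarrow> y \<bullet> t \<le> h y" by (rule ge)
  show "L-lipschitz_on UNIV h"
  proof (rule lipschitz_onI_real[OF _ L])
    fix x y
    show "h x \<le> h y + L * norm (x - y)"
    proof (rule least)
      fix t assume t: "t \<in> K"
      show "x \<bullet> t \<le> h y + L * norm (x - y)"
        using ge[OF t, of y] le[OF t, of "x - y"] by (simp add: inner_diff_left)
    qed
  qed
  show "h (c *\<^sub>R y) \<le> c * h y" if "0 \<le> c"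
    using ge that by (intro least) (auto intro!: mult_left_mono)
qed

section \<open>Gradients and increments of differentiable functions\<close>

lemma GDERIV_grad:
  fixes f :: "'a::euclidean_space \<Rightarrow> real"
  assumes "f differentiable (at x)"
  shows "GDERIV f x :> grad f x"
proof -
  obtain D where D: "(f has_derivative D) (at x)"
    using assms by (auto simp: differentiable_def)
  \<comment> \<open>The vector representing \<open>D\<close> through the inner product has the
    coordinates \<open>D b\<close>; by uniqueness it is the value of the description operator in
    \<open>grad\<close>.\<close>
  have "D y = y \<bullet> (\<Sum>b\<in>Basis. D b *\<^sub>R b)" for y
  proof -
    have lin: "linear D" using D by (rule has_derivative_linear)
    have "D y = D (\<Sum>b\<in>Basis. (y \<bullet> b) *\<^sub>R b)" by (simp add: euclidean_representation)
    also have "\<dots> = (\<Sum>b\<in>Basis. (y \<bullet> b) * D b)"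
      by (simp add: linear_sum[OF lin] linear_scale[OF lin])
    finally show ?thesis by (simp add: inner_sum_right mult.commute)
  qed
  then have "D = (\<lambda>y. y \<bullet> (\<Sum>b\<in>Basis. D b *\<^sub>R b))" ..
  then have G: "GDERIV f x :> (\<Sum>b\<in>Basis. D b *\<^sub>R b)"
    using D unfolding gderiv_def by metis
  then show ?thesis using grad_eqI by metis
qed

text \<open>The mean value theorem along the segment from \<open>x\<close> to \<open>x + y\<close>.
  With the support function as \<open>M\<close> it bounds increments by \<open>h\<close>, and with
  \<open>L * norm y\<close> it gives the Lipschitz bound.\<close>

lemma differentiable_increment_le:
  fixes f :: "'a::euclidean_space \<Rightarrow> real"
  assumes f: "\<And>x. f differentiable (at x)" and h: "\<And>x. y \<bullet> grad f x \<le> M"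
  shows "f (x + y) \<le> f x + M"
proof -
  have "((\<lambda>s. f (x + s *\<^sub>R y)) has_real_derivative y \<bullet> grad f (x + s *\<^sub>R y)) (at s)" for s :: real
  proof -
    have d: "(f has_derivative (\<lambda>h. h \<bullet> grad f (x + s *\<^sub>R y))) (at (x + s *\<^sub>R y))"
      using GDERIV_grad[OF f] by (simp add: gderiv_def)
    have "((\<lambda>s. x + s *\<^sub>R y) has_derivative (\<lambda>s. s *\<^sub>R y)) (at s)"
      by (auto intro!: derivative_eq_intros)
    from has_derivative_compose[OF this d]
    show ?thesis by (simp add: has_field_derivative_def mult_commute_abs)
  qed
  then obtain z where "f (x + 1 *\<^sub>R y) - f (x + 0 *\<^sub>R y) = (1 - 0) * (y \<bullet> grad f (x + z *\<^sub>R y))"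
    using MVT2[of 0 1 "\<lambda>s. f (x + s *\<^sub>R y)" "\<lambda>s. y \<bullet> grad f (x + s *\<^sub>R y)"] by auto
  then show ?thesis using h[of "x + z *\<^sub>R y"] by simp
qed

section \<open>Dilations, Jensen's inequality and second moments\<close>

lemma gauss_density_scale:
  fixes y :: "'a::euclidean_space"
  shows "gauss_density ((1 / c) *\<^sub>R y) = gauss_density y * exp ((1 - 1 / c\<^sup>2) * (norm y)\<^sup>2 / 2)"
proof -
  have "(norm ((1 / c) *\<^sub>R y))\<^sup>2 = (norm y)\<^sup>2 / c\<^sup>2"
    by (simp add: power_divide)
  then have "- (norm ((1 / c) *\<^sub>R y))\<^sup>2 / 2 = - (norm y)\<^sup>2 / 2 + (1 - 1 / c\<^sup>2) * (norm y)\<^sup>2 / 2"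
    by (simp only:) (simp add: left_diff_distrib diff_divide_distrib)
  then show ?thesis by (simp only: gauss_density_def exp_add mult.assoc)
qed

text \<open>Jensen's inequality, after the change of variables \<open>y = c x\<close> has turned the left-hand side
  into an exponential moment of \<open>density std_gaussian (exp \<circ> f)\<close>.\<close>

lemma ln_gaussian_exp_scale_ge:
  fixes F f :: "'a::euclidean_space \<Rightarrow> real"
  assumes c: "0 < c" and [measurable]: "F \<in> borel_measurable borel" "f \<in> borel_measurable borel"
    and F: "integrable std_gaussian (\<lambda>x. exp (F (c *\<^sub>R x)))"
    and \<nu>: "\<nu> = density std_gaussian (\<lambda>x. ennreal (exp (f x)))" "prob_space \<nu>"
    and int: "integrable \<nu> F" "integrable \<nu> f" "integrable \<nu> (\<lambda>x. (norm x)\<^sup>2)"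
  shows "(\<integral>x. F x \<partial>\<nu>) - (\<integral>x. f x \<partial>\<nu>) + (1 - 1 / c\<^sup>2) * (\<integral>x. (norm x)\<^sup>2 \<partial>\<nu>) / 2 - DIM('a) * ln c
    \<le> ln (\<integral>x. exp (F (c *\<^sub>R x)) \<partial>std_gaussian)"
proof -
  interpret \<nu>: prob_space \<nu> by fact
  let ?k = "1 - 1 / c\<^sup>2"
  \<comment> \<open>\<open>u\<close> is the logarithm of a density relative to \<nu>, namely that of
    the image under dilation by \<open>c\<close> of the measure with Gaussian density
    \<open>exp (F (c *\<^sub>R x))\<close>. The term with \<open>ln c\<close> is the
    Jacobian.\<close>
  define u where "u x = F x - f x + ?k * (norm x)\<^sup>2 / 2 - DIM('a) * ln c" for x
  have [measurable]: "u \<in> borel_measurable borel" unfolding u_def by measurable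
  have iu: "integrable \<nu> u"
    unfolding u_def using int by auto
  have eq: "gauss_density y * exp (f y) * exp (u y) = (1 / c) ^ DIM('a) * (gauss_density ((1 / c) *\<^sub>R y) * exp (F y))" for y
  proof -
    have "exp (DIM('a) * ln c) = c ^ DIM('a)"
      using c by (simp add: exp_of_nat_mult)
    then have "exp (u y) = exp (F y) / exp (f y) * exp (?k * (norm y)\<^sup>2 / 2) / c ^ DIM('a)"
      by (simp only: u_def exp_add exp_diff)
    then show ?thesis
      by (simp add: gauss_density_scale power_one_over)
  qed
  have intF: "integrable lborel (\<lambda>x. gauss_density x * exp (F (c *\<^sub>R x)))"
    using F by (simp add: integrable_gaussian_iff)
  have "ennreal (\<bar>c\<bar> ^ DIM('a)) * (\<integral>\<^sup>+x. ennreal (gauss_density x * exp (F (c *\<^sub>R x))) \<partial>lborel) < \<infinity>"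
    using intF by (simp add: ennreal_mult_less_top integrable_iff_bounded)
  also have "ennreal (\<bar>c\<bar> ^ DIM('a)) * (\<integral>\<^sup>+x. ennreal (gauss_density x * exp (F (c *\<^sub>R x))) \<partial>lborel)
     = (\<integral>\<^sup>+y. ennreal (gauss_density ((1 / c) *\<^sub>R y) * exp (F y)) \<partial>lborel)"
    using c by (subst (2) nn_integral_lborel_affine[of _ c 0]) auto
  finally have intF': "integrable lborel (\<lambda>y. gauss_density ((1 / c) *\<^sub>R y) * exp (F y))"
    by (intro integrableI_nonneg) auto
  have exp_u: "integrable lborel (\<lambda>y. gauss_density y * exp (f y) * exp (u y))"
    unfolding eq using intF' by simp
  have ieu: "integrable \<nu> (\<lambda>y. exp (u y))"
    unfolding \<nu> using exp_u by (subst integrable_density) (auto simp: integrable_gaussian_iff mult.assoc)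
  have "(\<integral>y. exp (u y) \<partial>\<nu>) = (\<integral>y. gauss_density y * exp (f y) * exp (u y) \<partial>lborel)"
    unfolding \<nu> by (subst integral_density) (auto simp: integral_gaussian mult.assoc)
  also have "\<dots> = (1 / c) ^ DIM('a) * (\<integral>y. gauss_density ((1 / c) *\<^sub>R y) * exp (F y) \<partial>lborel)"
    unfolding eq by simp
  also have "\<dots> = (\<integral>x. gauss_density x * exp (F (c *\<^sub>R x)) \<partial>lborel)"
    using c by (subst integral_lborel_affine[of _ c 0]) (auto simp: power_one_over)
  finally have "(\<integral>y. exp (u y) \<partial>\<nu>) = (\<integral>x. exp (F (c *\<^sub>R x)) \<partial>std_gaussian)"
    by (simp add: integral_gaussian)
  moreover have "(\<integral>x. F x \<partial>\<nu>) - (\<integral>x. f x \<partial>\<nu>) + ?k * (\<integral>x. (norm x)\<^sup>2 \<partial>\<nu>) / 2 - DIM('a) * ln c = (\<integral>x. u x \<partial>\<nu>)"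
    unfolding u_def using int by (simp add: \<nu>.prob_space)
  ultimately show ?thesis
    using \<nu>.expectation_le_ln_expectation_exp[OF iu ieu] by simp
qed

lemma gaussian_integrable_norm_power2: "integrable (std_gaussian :: 'a::euclidean_space measure) (\<lambda>x. (norm x)\<^sup>2)"
proof (rule Bochner_Integration.integrable_bound[OF gaussian_integrable_exp_norm[of 2]])
  show "AE x::'a in std_gaussian. norm ((norm x)\<^sup>2) \<le> norm (exp (2 * norm x))"
  proof (rule AE_I2)
    fix x :: 'a
    have "norm x \<le> exp (norm x)" using exp_ge_add_one_self[of "norm x"] by linarith
    then have "(norm x)\<^sup>2 \<le> (exp (norm x))\<^sup>2" by (rule power_mono) simp
    then show "norm ((norm x)\<^sup>2) \<le> norm (exp (2 * norm x))"
      by (simp add: exp_double)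
  qed
qed simp

text \<open>The scaling inequality is applied to the Gaussian itself, with both functions 0. For
  \<open>c < 1\<close> the factor \<open>1 - 1 / c^2\<close> is negative, so dividing by it reverses
  the inequality into a lower bound for \<open>?m\<close>; the resulting quotient tends to 1 as
  \<open>c\<close> tends to 1.\<close>

lemma gaussian_second_moment_ge:
  "real DIM('a::euclidean_space) \<le> (\<integral>x. (norm x)\<^sup>2 \<partial>(std_gaussian :: 'a measure))"
proof -
  let ?m = "\<integral>x. (norm x)\<^sup>2 \<partial>(std_gaussian :: 'a measure)"
  have ineq: "(1 - 1 / c\<^sup>2) * ?m / 2 \<le> DIM('a) * ln c" if "0 < c" for c
    using ln_gaussian_exp_scale_ge[OF that, of "\<lambda>_. 0 :: real" "\<lambda>_::'a. 0" std_gaussian]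
      gaussian_integrable_norm_power2[where 'a='a] prob_space_std_gaussian[where 'a='a]
    by (simp add: density_1)
  \<comment> \<open>Two successors, so that already \<open>c 0 = 1/2\<close> is positive.\<close>
  define c where "c n = 1 - 1 / real (Suc (Suc n))" for n
  have "real DIM('a) * ((ln (c n)) / ((1 - 1 / (c n)\<^sup>2) / 2)) \<le> ?m" for n
  proof -
    have "0 < c n" "c n < 1" by (auto simp: c_def field_simps)
    then have "(c n)\<^sup>2 < 1" "0 < (c n)\<^sup>2" by (auto simp: abs_square_less_1)
    then have neg: "(1 - 1 / (c n)\<^sup>2) / 2 < 0" by (simp add: less_divide_eq)
    have "?m * ((1 - 1 / (c n)\<^sup>2) / 2) \<le> real DIM('a) * ln (c n)"
      using ineq[OF \<open>0 < c n\<close>] by (simp add: mult.commute)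
    from iffD2[OF neg_divide_le_eq[OF neg] this] show ?thesis
      by (simp only: times_divide_eq_right)
  qed
  moreover have "(\<lambda>n. real DIM('a) * ((ln (c n)) / ((1 - 1 / (c n)\<^sup>2) / 2))) \<longlonglongrightarrow> real DIM('a) * 1"
    unfolding c_def by (intro tendsto_intros) real_asymp
  ultimately show ?thesis
    using LIMSEQ_le_const2[of _ "real DIM('a) * 1" ?m] by auto
qed

text \<open>Comparison with \<open>\<kappa> = c\<close> bounds a scaled exponential moment from
  above, and Jensen's inequality bounds it from below. Both bounds vanish at \<open>c = 1\<close>,
  so dividing by \<open>c - 1\<close> compares their derivatives there. The dimension left over by
  \<open>ln c / (c - 1)\<close> is absorbed by the Gaussian second moment.\<close>

lemma reverse_log_Sobolev:
  fixes f h :: "'a::euclidean_space \<Rightarrow> real"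
  assumes f: "L-lipschitz_on UNIV f" and h: "C-lipschitz_on UNIV h"
    and fh: "\<And>x y. f (x + y) \<le> f x + h y" and hom: "\<And>c y. 0 \<le> c \<Longrightarrow> h (c *\<^sub>R y) \<le> c * h y"
    and \<nu>: "\<nu> = density std_gaussian (\<lambda>x. ennreal (exp (f x)))" "prob_space \<nu>"
    and int: "integrable \<nu> f" "integrable \<nu> (\<lambda>x. (norm x)\<^sup>2)"
  shows "(\<integral>x. (norm x)\<^sup>2 \<partial>\<nu>) - (\<integral>x. (norm x)\<^sup>2 \<partial>(std_gaussian :: 'a measure))
    \<le> 2 * (\<integral>x. f x \<partial>\<nu>) + (\<integral>y. h y \<partial>std_gaussian)"
proof -
  let ?M = "\<integral>x. (norm x)\<^sup>2 \<partial>\<nu>" and ?D = "\<integral>x. f x \<partial>\<nu>" and ?H = "\<integral>y. h y \<partial>std_gaussian" and ?n = "real DIM('a)"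
  have [measurable]: "f \<in> borel_measurable borel" using f by (rule lipschitz_measurable)
  have ief: "integrable std_gaussian (\<lambda>x. exp (f x))" by (rule gaussian_integrable_exp_lipschitz[OF f])
  \<comment> \<open>The normalization of \<nu> makes \<open>hopf_cole 1 1 f 0\<close>
    vanish.\<close>
  have one: "(\<integral>x. exp (f x) \<partial>std_gaussian) = 1"
  proof -
    have "ennreal (\<integral>x. exp (f x) \<partial>std_gaussian) = (\<integral>\<^sup>+x. ennreal (exp (f x)) \<partial>std_gaussian)"
      by (rule nn_integral_eq_integral[symmetric]) (use ief in auto)
    also have "\<dots> = emeasure \<nu> (space \<nu>)"
      unfolding \<nu> by (subst emeasure_density) auto
    also have "\<dots> = 1" by (rule prob_space.emeasure_space_1[OF \<nu>(2)])
    finally show ?thesis by simp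
  qed
  have main: "(1 + c) * (?M - 2 * ?D) / 2 - c\<^sup>2 * ?n * (ln c / (c - 1)) \<le> ?H" if c: "1 < c" for c
  proof -
    have c0: "0 < c" "0 < c\<^sup>2" using c by auto
    have fc: "(L / c\<^sup>2)-lipschitz_on UNIV (\<lambda>x. f x / c\<^sup>2)"
      using f c0(2) by (rule lipschitz_on_divide)
    \<comment> \<open>The comparison moves \<open>f\<close> by \<open>(c - 1) *\<^sub>R y\<close>,
      so its majorant is \<open>h\<close> dilated by \<open>c - 1\<close>; homogeneity later
      extracts that factor.\<close>
    have hc: "(C * \<bar>c - 1\<bar>)-lipschitz_on UNIV (\<lambda>y. h ((c - 1) *\<^sub>R y))"
      using lipschitz_scale[OF h, of "c - 1" 0] by simp
    have "hopf_cole (c\<^sup>2) 1 f 0 \<le> hopf_cole 1 1 f 0 + heat 1 (\<lambda>y. h ((c - 1) *\<^sub>R y)) 0"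
      by (rule hopf_cole_comparison[OF f hc c0(1)]) (rule fh)
    also have "hopf_cole 1 1 f 0 = 0"
      by (simp add: hopf_cole_def one)
    also have "heat 1 (\<lambda>y. h ((c - 1) *\<^sub>R y)) 0 \<le> (\<integral>y. (c - 1) * h y \<partial>std_gaussian)"
      using integral_mono[OF gaussian_integrable_lipschitz[OF hc] integrable_mult_right[OF gaussian_integrable_lipschitz[OF h]], of "c - 1"]
        c hom[of "c - 1"] by (simp add: heat_def)
    also have "\<dots> = (c - 1) * ?H" by simp
    finally have 1: "c\<^sup>2 * ln (\<integral>x. exp (f (c *\<^sub>R x) / c\<^sup>2) \<partial>std_gaussian) \<le> (c - 1) * ?H"
      using c0 by (simp add: hopf_cole_def)
    have "?D / c\<^sup>2 - ?D + (1 - 1 / c\<^sup>2) * ?M / 2 - ?n * ln c \<le> ln (\<integral>x. exp (f (c *\<^sub>R x) / c\<^sup>2) \<partial>std_gaussian)"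
      using ln_gaussian_exp_scale_ge[OF c0(1), of "\<lambda>x. f x / c\<^sup>2" f \<nu>] \<nu> int
        lipschitz_integrable_shift_scale(2)[OF fc, of 0 c] by simp
    then have "c\<^sup>2 * (?D / c\<^sup>2 - ?D + (1 - 1 / c\<^sup>2) * ?M / 2 - ?n * ln c) \<le> (c - 1) * ?H"
      using c0 1 by (meson mult_left_mono less_imp_le order_trans)
    also have "c\<^sup>2 * (?D / c\<^sup>2 - ?D + (1 - 1 / c\<^sup>2) * ?M / 2 - ?n * ln c)
        = (c\<^sup>2 - 1) * ((?M - 2 * ?D) / 2) - c\<^sup>2 * ?n * ln c"
      using c0 by (simp add: field_simps)
    \<comment> \<open>Each term is rewritten with a factor \<open>c - 1\<close>, which is positive
      and cancels at the end.\<close>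
    also have "c\<^sup>2 * ?n * ln c = (c - 1) * (c\<^sup>2 * ?n * (ln c / (c - 1)))"
      using c by simp
    also have "c\<^sup>2 - 1 = (c - 1) * (1 + c)"
      by (simp add: power2_eq_square algebra_simps)
    also have "(c - 1) * (1 + c) * ((?M - 2 * ?D) / 2) - (c - 1) * (c\<^sup>2 * ?n * (ln c / (c - 1)))
        = (c - 1) * ((1 + c) * (?M - 2 * ?D) / 2 - c\<^sup>2 * ?n * (ln c / (c - 1)))"
      by (simp only: right_diff_distrib mult.assoc times_divide_eq_right)
    finally show ?thesis using c by simp
  qed
  define c where "c n = 1 + 1 / real (Suc n)" for n
  have c: "1 < c n" for n by (simp add: c_def)
  have "c \<longlonglongrightarrow> 1" and "(\<lambda>n. ln (c n) / (c n - 1)) \<longlonglongrightarrow> 1"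
    unfolding c_def by real_asymp+
  then have "(\<lambda>n. (1 + c n) * (?M - 2 * ?D) / 2 - (c n)\<^sup>2 * ?n * (ln (c n) / (c n - 1))) \<longlonglongrightarrow> (1 + 1) * (?M - 2 * ?D) / 2 - 1\<^sup>2 * ?n * 1"
    by (intro tendsto_intros) auto
  then have "(1 + 1) * (?M - 2 * ?D) / 2 - 1\<^sup>2 * ?n * 1 \<le> ?H"
    by (rule LIMSEQ_le_const2) (use main c in blast)
  then show ?thesis
    using gaussian_second_moment_ge[where 'a='a] by (simp add: diff_divide_distrib)
qed

theorem theorem3:
  fixes f :: "real ^ 'n \<Rightarrow> real" and \<nu> :: "(real ^ 'n) measure" and K :: "(real ^ 'n) set"
  assumes "twice_differentiable f"
    and "\<nu> = density std_gaussian (\<lambda>x. ennreal (exp (f x)))"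
    and "prob_space \<nu>"
    and "integrable \<nu> f"
    and "integrable \<nu> (\<lambda>x. (norm (grad f x))\<^sup>2)"
    and "K = range (grad f)"
    and "ereal_integrable std_gaussian (support_fun K)"
    and "integrable \<nu> (\<lambda>x. (norm x)\<^sup>2)"
  shows "(\<integral>x. (norm x)\<^sup>2 \<partial>\<nu>) - (\<integral>x. (norm x)\<^sup>2 \<partial>(std_gaussian :: (real ^ 'n) measure))
    \<le> 2 * KL_divergence (exp 1) std_gaussian \<nu> + gaussian_width K"
proof -
  have diff: "f differentiable (at x)" for x
    using assms(1) by (simp add: twice_differentiable_def)
  \<comment> \<open>Integrability of the support function enters here: it bounds all gradients by
    one \<open>L\<close>, which serves as Lipschitz constant of both \<open>h\<close> and
    \<open>f\<close>.\<close>
  obtain L where L: "\<And>t. t \<in> K \<Longrightarrow> norm t \<le> L"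
    using ereal_integrable_imp_bounded[OF assms(7)] by (auto simp: bounded_iff)
  have K: "K \<noteq> {}" "\<And>x. grad f x \<in> K" using assms(6) by auto
  define h where "h y = real_of_ereal (support_fun K y)" for y
  have lh: "L-lipschitz_on UNIV h"
    unfolding h_def using K(1) L by (rule support_fun_bounded(1))
  have ge: "y \<bullet> t \<le> h y" if "t \<in> K" for y t
    unfolding h_def using K(1) L that by (rule support_fun_bounded(2))
  have hom: "h (c *\<^sub>R y) \<le> c * h y" if "0 \<le> c" for c y
    unfolding h_def using K(1) L that by (rule support_fun_bounded(3))
  have fh: "f (x + y) \<le> f x + h y" for x y
    by (rule differentiable_increment_le[OF diff]) (rule ge[OF K(2)])
  have lf: "L-lipschitz_on UNIV f"
  proof (rule lipschitz_onI_real)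
    show "0 \<le> L" using L[OF K(2)] norm_ge_zero order_trans by blast
    fix x y
    have "(x - y) \<bullet> grad f z \<le> L * norm (x - y)" for z
      using Cauchy_Schwarz_ineq2[of "x - y" "grad f z"] mult_left_mono[OF L[OF K(2)[of z]], of "norm (x - y)"]
      by (simp add: mult.commute)
    from differentiable_increment_le[OF diff this, of y]
    show "f x \<le> f y + L * norm (x - y)" by simp
  qed
  have "KL_divergence (exp 1) std_gaussian \<nu> = (\<integral>x. f x \<partial>\<nu>)"
    unfolding assms(2) by (rule KL_divergence_exp_density[OF lipschitz_measurable[OF lf]])
  moreover have "gaussian_width K = (\<integral>y. h y \<partial>std_gaussian)"
    by (simp add: gaussian_width_def h_def)
  ultimately show ?thesis
    using reverse_log_Sobolev[OF lf lh fh hom assms(2,3,4,8)] by simp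
qed

end
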